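(* Let $p$ be an odd prime and let $x$ be a $p$-adic integer. For $n\in\mathbb{N}$ put $$t_n(x)=\sum_{k=0}^n\binom{n}{k}\binom{x}{k}\binom{x+k}{k}2^k.$$ Then $$\sum_{n=0}^{p-1}t_n(x)^2\equiv\begin{cases}\left(\dfrac{-1}{p}\right)\pmod{p^2},&\text{if } 2x\equiv-1\pmod{p},\\[8pt](-1)^{\langle x\rangle_p}\dfrac{p+2(x-\langle x\rangle_p)}{2x+1}\pmod{p^2},&\text{otherwise.}\end{cases}$$
   Context: For a $p$-adic integer $x$ and $k\in\mathbb{N}$, $\binom{x}{k}=x(x-1)\cdots(x-k+1)/k!$. $\langle x\rangle_p$ denotes the least nonnegative residue of $x$ modulo $p$, i.e. the unique integer $m\in\{0,1,\dots,p-1\}$ with $x\equiv m\pmod p$. $\left(\frac{\cdot}{p}\right)$ is the Legendre symbol. Congruences between $p$-adic numbers are understood in $\mathbb{Z}_p$ (when $2x+1\not\equiv0\pmod p$, the fraction is a $p$-adic integer). *)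

theory Defs
  imports
    "HOL-Computational_Algebra.Fraction_Field"
    "HOL-Computational_Algebra.Polynomial_Factorial"
    "HOL-Number_Theory.Number_Theory"
    "Berlekamp_Zassenhaus.Finite_Field"
begin

text \<open>
  The ring of \<open>p\<close>-adic integers is the inverse limit of the rings \<open>\<int>/p\<^sup>n\<int>\<close>, for
  \<open>p = CARD('p)\<close> prime. An element is a compatible sequence of residues; the equation below
  also forces \<open>0 \<le> f n < p\<^sup>n\<close>.
\<close>

typedef (overloaded) 'p::prime_card padic_int =
  "{f :: nat \<Rightarrow> int. \<forall>n. f n = f (Suc n) mod int CARD('p) ^ n}"
  morphisms padic_residue Abs_padic_int
  by (rule exI[of _ "\<lambda>_. 0"]) simp

setup_lifting type_definition_padic_int

lemma mod_mod_power_Suc: "(a mod (p::int) ^ Suc n) mod p ^ n = a mod p ^ n"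
  by (rule mod_mod_cancel) simp

lemma compatible_mod:
  fixes q :: int
  assumes f: "\<forall>n. f n = f (Suc n) mod q ^ n" and g: "\<forall>n. g n = g (Suc n) mod q ^ n"
  shows "(f n + g n) mod q ^ n = (f (Suc n) + g (Suc n)) mod q ^ Suc n mod q ^ n"
    and "(f n - g n) mod q ^ n = (f (Suc n) - g (Suc n)) mod q ^ Suc n mod q ^ n"
    and "(f n * g n) mod q ^ n = (f (Suc n) * g (Suc n)) mod q ^ Suc n mod q ^ n"
proof -
  have f': "f n = f (Suc n) mod q ^ n" and g': "g n = g (Suc n) mod q ^ n"
    using f g by blast+
  show "(f n + g n) mod q ^ n = (f (Suc n) + g (Suc n)) mod q ^ Suc n mod q ^ n"
    unfolding mod_mod_power_Suc f' g' by (rule mod_add_eq)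
  show "(f n - g n) mod q ^ n = (f (Suc n) - g (Suc n)) mod q ^ Suc n mod q ^ n"
    unfolding mod_mod_power_Suc f' g' by (rule mod_diff_eq)
  show "(f n * g n) mod q ^ n = (f (Suc n) * g (Suc n)) mod q ^ Suc n mod q ^ n"
    unfolding mod_mod_power_Suc f' g' by (rule mod_mult_eq)
qed

lemma compatible_minus_mod:
  fixes q :: int
  assumes f: "\<forall>n. f n = f (Suc n) mod q ^ n"
  shows "(- f n) mod q ^ n = (- f (Suc n)) mod q ^ Suc n mod q ^ n"
proof -
  have f': "f n = f (Suc n) mod q ^ n"
    using f by blast
  show ?thesis
    unfolding mod_mod_power_Suc f' by (rule mod_minus_eq)
qed

lemma padic_int_eqI: "(\<And>n. padic_residue a n = padic_residue b n) \<Longrightarrow> a = b"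
  by (simp add: padic_residue_inject[symmetric] fun_eq_iff)

lemma padic_residue_Suc:
  "padic_residue (a :: 'p::prime_card padic_int) (Suc n) mod int CARD('p) ^ n = padic_residue a n"
proof -
  have "\<forall>n. padic_residue a n = padic_residue a (Suc n) mod int CARD('p) ^ n"
    using padic_residue[of a] unfolding mem_Collect_eq .
  then have "padic_residue a n = padic_residue a (Suc n) mod int CARD('p) ^ n"
    by (rule spec)
  then show ?thesis
    by (rule sym)
qed

lemma padic_residue_mod_self [simp]:
  "padic_residue (a :: 'p::prime_card padic_int) n mod int CARD('p) ^ n = padic_residue a n"
  by (metis padic_residue_Suc mod_mod_trivial)

lemma padic_residue_add_mod:
  "padic_residue (a :: 'p::prime_card padic_int) (n + k) mod int CARD('p) ^ n = padic_residue a n"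
proof (induction k)
  case (Suc k)
  have "padic_residue a (n + Suc k) mod int CARD('p) ^ n
      = (padic_residue a (Suc (n + k)) mod int CARD('p) ^ (n + k)) mod int CARD('p) ^ n"
    by (simp add: mod_mod_cancel power_add)
  then show ?case
    using Suc by (simp only: padic_residue_Suc)
qed simp

instantiation padic_int :: (prime_card) comm_ring_1
begin

lift_definition zero_padic_int :: "'a padic_int" is "\<lambda>_. 0"
  by simp

lift_definition one_padic_int :: "'a padic_int" is "\<lambda>n. 1 mod int CARD('a) ^ n"
  by (simp only: mod_mod_power_Suc)

lift_definition plus_padic_int :: "'a padic_int \<Rightarrow> 'a padic_int \<Rightarrow> 'a padic_int"
  is "\<lambda>f g n. (f n + g n) mod int CARD('a) ^ n"
  by (rule compatible_mod; blast)

lift_definition uminus_padic_int :: "'a padic_int \<Rightarrow> 'a padic_int"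
  is "\<lambda>f n. (- f n) mod int CARD('a) ^ n"
  by (rule compatible_minus_mod; blast)

lift_definition minus_padic_int :: "'a padic_int \<Rightarrow> 'a padic_int \<Rightarrow> 'a padic_int"
  is "\<lambda>f g n. (f n - g n) mod int CARD('a) ^ n"
  by (rule compatible_mod; blast)

lift_definition times_padic_int :: "'a padic_int \<Rightarrow> 'a padic_int \<Rightarrow> 'a padic_int"
  is "\<lambda>f g n. (f n * g n) mod int CARD('a) ^ n"
  by (rule compatible_mod; blast)

instance
proof
  fix a b c :: "'a padic_int"
  note defs = zero_padic_int.rep_eq one_padic_int.rep_eq plus_padic_int.rep_eq
    uminus_padic_int.rep_eq minus_padic_int.rep_eq times_padic_int.rep_eq
  show "a * b * c = a * (b * c)"
    by (rule padic_int_eqI) (simp add: defs mod_simps mult.assoc)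
  show "a * b = b * a"
    by (rule padic_int_eqI) (simp add: defs mult.commute)
  show "1 * a = a"
    by (rule padic_int_eqI) (simp add: defs mod_simps)
  show "a + b + c = a + (b + c)"
    by (rule padic_int_eqI) (simp add: defs mod_simps add.assoc)
  show "a + b = b + a"
    by (rule padic_int_eqI) (simp add: defs add.commute)
  show "0 + a = a"
    by (rule padic_int_eqI) (simp add: defs)
  show "- a + a = 0"
    by (rule padic_int_eqI) (simp add: defs mod_simps)
  show "a - b = a + - b"
    by (rule padic_int_eqI) (simp add: defs mod_simps)
  show "(a + b) * c = a * c + b * c"
    by (rule padic_int_eqI) (simp add: defs mod_simps distrib_right)
  have "padic_residue (1 :: 'a padic_int) 1 \<noteq> padic_residue 0 1"
    using prime_gt_1_nat[OF prime_card[where 'a='a]] by (simp add: defs)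
  then show "(0 :: 'a padic_int) \<noteq> 1"
    by auto
qed

end

lemma padic_residue_of_nat:
  "padic_residue (of_nat m :: 'p::prime_card padic_int) n = int m mod int CARD('p) ^ n"
  by (induction m)
    (simp_all add: zero_padic_int.rep_eq one_padic_int.rep_eq plus_padic_int.rep_eq mod_simps)

instance padic_int :: (prime_card) idom
proof
  fix a b :: "'a padic_int"
  let ?p = "int CARD('a)"
  assume "a \<noteq> 0" and "b \<noteq> 0"
  have ex: "\<exists>n. padic_residue c n \<noteq> 0" if "c \<noteq> 0" for c :: "'a padic_int"
    using that padic_int_eqI[of c 0] unfolding zero_padic_int.rep_eq by blast
  obtain i j where ij: "padic_residue a i \<noteq> 0" "padic_residue b j \<noteq> 0"
    using ex[OF \<open>a \<noteq> 0\<close>] ex[OF \<open>b \<noteq> 0\<close>] by blast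
  let ?A = "padic_residue a (i + j)" and ?B = "padic_residue b (i + j)"
  have "?A mod ?p ^ i = padic_residue a i"
    by (rule padic_residue_add_mod)
  moreover have "?B mod ?p ^ j = padic_residue b j"
    using padic_residue_add_mod[of b j i] by (simp add: add.commute)
  ultimately have A: "\<not> ?p ^ i dvd ?A" and B: "\<not> ?p ^ j dvd ?B"
    using ij by (simp_all add: dvd_eq_mod_eq_0)
  have p: "prime ?p"
    by (rule prime_card_int)
  have nz: "?A \<noteq> 0" "?B \<noteq> 0"
    using A B by auto
  have fin: "\<not> is_unit ?p"
    using p not_prime_unit by blast
  have "multiplicity ?p ?A < i" "multiplicity ?p ?B < j"
    using A B nz fin by (auto intro!: multiplicity_lessI)
  then have "multiplicity ?p (?A * ?B) < i + j"
    using p nz by (simp add: prime_elem_multiplicity_mult_distrib)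
  then have "\<not> ?p ^ (i + j) dvd ?A * ?B"
    using nz fin by (simp add: power_dvd_iff_le_multiplicity)
  then have "padic_residue (a * b) (i + j) \<noteq> padic_residue 0 (i + j)"
    by (simp add: times_padic_int.rep_eq zero_padic_int.rep_eq dvd_eq_mod_eq_0)
  then show "a * b \<noteq> 0"
    by auto
qed

instance padic_int :: (prime_card) ring_char_0
proof
  show "inj (of_nat :: nat \<Rightarrow> 'a padic_int)"
  proof (rule injI)
    fix m n :: nat
    assume eq: "(of_nat m :: 'a padic_int) = of_nat n"
    have "1 < CARD('a)"
      using prime_gt_1_nat[OF prime_card] .
    then have lt: "m + n < CARD('a) ^ (m + n)"
      by (simp add: power_gt_expt)
    have "int m mod int CARD('a) ^ (m + n) = int n mod int CARD('a) ^ (m + n)"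
      using eq by (metis padic_residue_of_nat)
    then have "m mod CARD('a) ^ (m + n) = n mod CARD('a) ^ (m + n)"
      by (metis of_nat_eq_iff of_nat_mod of_nat_power)
    then show "m = n"
      using lt by simp
  qed
qed

instance fract :: ("{idom, ring_char_0}") field_char_0
  by standard (auto intro!: injI simp: of_nat_fract eq_fract)

type_synonym 'p padic = "'p padic_int fract"

definition padic_ints :: "'p::prime_card padic set"
  where "padic_ints = range to_fract"

text \<open>Congruence of \<open>p\<close>-adic integers modulo \<open>m\<close>, as elements of the ring \<open>\<int>\<^sub>p\<close>.\<close>

definition padic_cong :: "'p::prime_card padic \<Rightarrow> 'p padic \<Rightarrow> 'p padic \<Rightarrow> bool"
  where "padic_cong a b m \<longleftrightarrow>
    a \<in> padic_ints \<and> b \<in> padic_ints \<and> (\<exists>c\<in>padic_ints. a - b = m * c)"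

definition least_residue :: "'p::prime_card padic \<Rightarrow> nat"
  where "least_residue x =
    (THE m. m < CARD('p) \<and> padic_cong x (of_nat m) (of_nat CARD('p)))"

lemma padic_int_dvd_iff:
  fixes a :: "'p::prime_card padic_int"
  shows "of_nat CARD('p) dvd a \<longleftrightarrow> padic_residue a 1 = 0"
proof
  assume "of_nat CARD('p) dvd a"
  then show "padic_residue a 1 = 0"
    by (auto simp: times_padic_int.rep_eq padic_residue_of_nat)
next
  let ?p = "int CARD('p)"
  assume a: "padic_residue a 1 = 0"
  have p0: "?p \<noteq> 0"
    using prime_card_int[where 'a='p] by (metis not_prime_0)
  define f where "f n = (padic_residue a (Suc n) div ?p) mod ?p ^ n" for n
  have dvd: "?p dvd padic_residue a (Suc n)" for n
    using padic_residue_add_mod[of a 1 n] a by (simp add: dvd_eq_mod_eq_0)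
  have step: "f n = f (Suc n) mod ?p ^ n" for n
  proof -
    obtain u where u: "padic_residue a (Suc (Suc n)) = ?p * u"
      using dvd by (meson dvdE)
    have "padic_residue a (Suc n) = ?p * u mod ?p ^ Suc n"
      using padic_residue_Suc[of a "Suc n"] unfolding u by (rule sym)
    then have "padic_residue a (Suc n) = ?p * (u mod ?p ^ n)"
      by (simp only: mult_mod_right power_Suc)
    then show ?thesis
      using u p0 unfolding f_def by (simp add: mod_mod_cancel)
  qed
  define c :: "'p padic_int" where "c = Abs_padic_int f"
  have c: "padic_residue c = f"
    unfolding c_def using step by (intro Abs_padic_int_inverse) blast
  have "a = of_nat CARD('p) * c"
  proof (rule padic_int_eqI)
    fix n
    have "padic_residue (of_nat CARD('p) * c) n
        = (?p * (padic_residue a (Suc n) div ?p)) mod ?p ^ n"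
      by (simp add: times_padic_int.rep_eq padic_residue_of_nat c f_def mod_simps)
    also have "\<dots> = padic_residue a n"
      using dvd by (simp add: padic_residue_Suc)
    finally show "padic_residue a n = padic_residue (of_nat CARD('p) * c) n"
      by simp
  qed
  then show "of_nat CARD('p) dvd a"
    by simp
qed

lemma of_nat_eq_to_fract: "of_nat n = to_fract (of_nat n)"
  by (simp add: to_fract_def of_nat_fract)

lemma padic_cong_to_fract_iff:
  "padic_cong (to_fract a) (to_fract b) (to_fract m) \<longleftrightarrow> m dvd a - b"
  by (auto simp: padic_cong_def padic_ints_def dvd_def
      simp flip: to_fract_diff to_fract_mult)

lemma least_residue_unique:
  fixes x :: "'p::prime_card padic"
  assumes "x \<in> padic_ints"
  shows "\<exists>!m. m < CARD('p) \<and> padic_cong x (of_nat m) (of_nat CARD('p))"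
proof -
  obtain a where x: "x = to_fract a"
    using assms by (auto simp: padic_ints_def)
  define r where "r = padic_residue a 1"
  have r: "r mod int CARD('p) = r"
    using padic_residue_mod_self[of a 1] by (simp add: r_def)
  have p: "0 < int CARD('p)"
    using prime_gt_0_int[OF prime_card_int[where 'a='p]] .
  have bounds: "0 \<le> r" "r < int CARD('p)"
    using r p by (metis pos_mod_sign, metis pos_mod_bound)
  have iff: "padic_cong x (of_nat m) (of_nat CARD('p)) \<longleftrightarrow> m = nat r" if "m < CARD('p)" for m
  proof -
    have "padic_cong x (of_nat m) (of_nat CARD('p)) \<longleftrightarrow> (r - int m) mod int CARD('p) = 0"
      unfolding x of_nat_eq_to_fract padic_cong_to_fract_iff padic_int_dvd_iff
      by (simp add: minus_padic_int.rep_eq padic_residue_of_nat r_def mod_simps)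
    also have "\<dots> \<longleftrightarrow> r mod int CARD('p) = int m mod int CARD('p)"
      by (simp add: mod_eq_dvd_iff dvd_eq_mod_eq_0)
    also have "\<dots> \<longleftrightarrow> m = nat r"
      using that bounds by auto
    finally show ?thesis .
  qed
  have "nat r < CARD('p)"
    using bounds by simp
  then show ?thesis
    using iff by blast
qed

definition t_poly :: "nat \<Rightarrow> 'a::field_char_0 \<Rightarrow> 'a"
  where "t_poly n x =
    (\<Sum>k=0..n. of_nat (n choose k) * (x gchoose k) * ((x + of_nat k) gchoose k) * 2 ^ k)"

end

theory Submission
  imports Defs
begin

text \<open>
  Write \<open>C(x,k) C(x+k,k) = \<Prod>i<k. (x(x+1) - i(i+1)) / k!\<^sup>2\<close>. This is invariant under
  \<open>x \<mapsto> -1-x\<close>, so one may assume \<open>a \<le> (p-1)/2\<close> for the residue \<open>a\<close> of \<open>x\<close>. Expanding the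
  squares leads to \<open>T(j,k) = \<Sum>n<p. C(n,j) C(n,k)\<close>, and for \<open>j + k < p\<close> a summation by parts
  shows \<open>T(j,k) \<equiv> p \<beta>(j,k) (mod p\<^sup>2)\<close> with
  \<open>\<beta>(j,k) = (-1)\<^sup>j\<^sup>+\<^sup>k j! k! / (j+k+1)! = \<integral>\<^sub>0\<^sup>1 (-y)\<^sup>j (y-1)\<^sup>k dy\<close>.

  With \<open>P(z) = \<Sum>k. C(a,k) C(a+k,k) z\<^sup>k\<close>, a shifted Legendre polynomial, the terms with
  \<open>j, k \<le> a\<close> therefore contribute \<open>p \<integral>\<^sub>0\<^sup>1 P(-2y) P(2y-2) dy\<close>. The integrand is symmetric
  under \<open>y \<mapsto> 1-y\<close>, so the integral equals \<open>\<integral>\<^sub>0\<^sup>1 P(-v) P(v-2) dv\<close>; by orthogonality only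
  the leading coefficient of the second factor matters and the value is \<open>(-1)\<^sup>a / (2a+1)\<close>.

  If \<open>2a+1 = p\<close>, all other terms vanish modulo \<open>p\<^sup>2\<close>. If \<open>2a+1 < p\<close>, the factor
  \<open>(x-a)(x+a+1)\<close>, and for \<open>k \<ge> p-a\<close> a second multiple of \<open>p\<close>, leave only the terms
  \<open>(a, p-1-a)\<close> and \<open>(p-1-a, a)\<close>, which Wilson's theorem evaluates to
  \<open>(-1)\<^sup>a (x-a) / (2a+1)\<close> each.
\<close>

section \<open>The Legendre integral\<close>

text \<open>The definite integral over \<open>[0,1]\<close>, made algebraic so that it is available over any field of
  characteristic 0.\<close>

definition has_unit_integral :: "'a::field_char_0 poly \<Rightarrow> 'a \<Rightarrow> bool"
  where "has_unit_integral F c \<longleftrightarrow> (\<exists>G. pderiv G = F \<and> poly G 1 - poly G 0 = c)"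

lemma has_unit_integral_unique:
  assumes "has_unit_integral F c" "has_unit_integral F d"
  shows "c = d"
proof -
  obtain G H where G: "pderiv G = F" "poly G 1 - poly G 0 = c"
    and H: "pderiv H = F" "poly H 1 - poly H 0 = d"
    using assms by (auto simp: has_unit_integral_def)
  have "pderiv (G - H) = 0"
    using G H by (simp add: pderiv_diff)
  then obtain h where "G - H = [:h:]"
    using pderiv_iszero by blast
  then have "poly (G - H) 1 = poly (G - H) 0"
    by simp
  then show ?thesis
    using G H by (simp add: algebra_simps)
qed

lemma has_unit_integral_smult:
  "has_unit_integral F c \<Longrightarrow> has_unit_integral (smult r F) (r * c)"
proof -
  assume "has_unit_integral F c"
  then obtain G where "pderiv G = F" "poly G 1 - poly G 0 = c"
    by (auto simp: has_unit_integral_def)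
  then show ?thesis
    unfolding has_unit_integral_def
    by (intro exI[of _ "smult r G"]) (simp add: pderiv_smult right_diff_distrib[symmetric])
qed

lemma has_unit_integral_add:
  "has_unit_integral F c \<Longrightarrow> has_unit_integral G d \<Longrightarrow> has_unit_integral (F + G) (c + d)"
proof -
  assume "has_unit_integral F c" "has_unit_integral G d"
  then obtain F' G' where "pderiv F' = F" "poly F' 1 - poly F' 0 = c"
    "pderiv G' = G" "poly G' 1 - poly G' 0 = d"
    by (auto simp: has_unit_integral_def)
  then show ?thesis
    unfolding has_unit_integral_def by (intro exI[of _ "F' + G'"]) (auto simp: pderiv_add)
qed

lemma has_unit_integral_diff:
  "has_unit_integral F c \<Longrightarrow> has_unit_integral G d \<Longrightarrow> has_unit_integral (F - G) (c - d)"
  using has_unit_integral_add[of F c "smult (-1) G" "-1 * d"] has_unit_integral_smult[of G d "-1"]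
  by simp

lemma has_unit_integral_sum:
  assumes "\<And>i. i \<in> A \<Longrightarrow> has_unit_integral (F i) (c i)"
  shows "has_unit_integral (\<Sum>i\<in>A. F i) (\<Sum>i\<in>A. c i)"
  using assms
proof (induction A rule: infinite_finite_induct)
  case (insert i A)
  then show ?case
    by (simp add: has_unit_integral_add)
qed (auto simp: has_unit_integral_def intro!: exI[of _ 0])

lemma has_unit_integral_monom:
  "has_unit_integral (monom 1 n :: 'a::field_char_0 poly) (1 / of_nat (Suc n))"
proof -
  have "pderiv (monom (1 / of_nat (Suc n)) (Suc n)) = (monom 1 n :: 'a poly)"
    using of_nat_neq_0[of n, where 'a='a] by (simp add: pderiv_monom del: of_nat_Suc)
  then show ?thesis
    unfolding has_unit_integral_def
    by (intro exI[of _ "monom (1 / of_nat (Suc n)) (Suc n)"]) (simp add: poly_monom)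
qed

text \<open>Mirrors \<open>y^j (1-y)^(k+1) = y^j (1-y)^k - y^(j+1) (1-y)^k\<close>, the recursion
  behind the beta integral.\<close>

lemma beta_fact_rec:
  "fact j * fact (Suc k) / fact (j + Suc k + 1)
    = (fact j * fact k / fact (j + k + 1) - fact (Suc j) * fact k / fact (Suc j + k + 1)
      :: 'a::field_char_0)"
proof -
  have e: "fact (j + k + 2) = of_nat (j + k + 2) * (fact (j + k + 1) :: 'a)"
    by (simp add: fact_reduce algebra_simps)
  have nz: "of_nat (j + k + 2) \<noteq> (0 :: 'a)"
    by (metis of_nat_eq_0_iff add_eq_0_iff_both_eq_0 zero_neq_numeral)
  have "fact j * fact k / fact (j + k + 1)
      = of_nat (j + k + 2) * (fact j * fact k) / (fact (j + k + 2) :: 'a)"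
    unfolding e using nz by simp
  then show ?thesis
    by (simp add: diff_divide_distrib[symmetric] algebra_simps)
qed

lemma has_unit_integral_beta:
  "has_unit_integral (monom 1 j * [:1, -1:] ^ k :: 'a::field_char_0 poly)
    (fact j * fact k / fact (j + k + 1))"
proof (induction k arbitrary: j)
  case 0
  have "fact j * fact 0 / fact (j + 0 + 1) = (1 / of_nat (Suc j) :: 'a)"
    by (simp del: of_nat_Suc)
  then show ?case
    using has_unit_integral_monom[of j] by simp
next
  case (Suc k)
  have "(monom 1 j * [:1, -1:] ^ Suc k :: 'a poly)
      = monom 1 j * [:1, -1:] ^ k - monom 1 (Suc j) * [:1, -1:] ^ k"
    by (rule poly_eq_poly_eq_iff[THEN iffD1])
      (simp add: fun_eq_iff poly_monom algebra_simps)
  then show ?case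
    using has_unit_integral_diff[OF Suc.IH[of j] Suc.IH[of "Suc j"]]
    by (simp only: beta_fact_rec)
qed

text \<open>By symmetry the integral over [0,1] is twice that over [0,1/2]; the substitution
  \<open>y = v/2\<close> absorbs the 2.\<close>

lemma has_unit_integral_halve:
  assumes F: "has_unit_integral F c" and sym: "pcompose F [:1, -1:] = F"
  shows "has_unit_integral (pcompose F [:0, 1 / 2:]) c"
proof -
  obtain G where G: "pderiv G = F" "poly G 1 - poly G 0 = c"
    using F by (auto simp: has_unit_integral_def)
  \<comment> \<open>\<open>G(y) + G(1-y)\<close> is constant, so \<open>G(1/2)\<close> lies midway
    between \<open>G(0)\<close> and \<open>G(1)\<close>.\<close>
  have "pderiv (G + pcompose G [:1, -1:]) = 0"
    using sym G by (simp add: pderiv_add pderiv_pcompose pderiv_pCons)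
  then obtain h where h: "G + pcompose G [:1, -1:] = [:h:]"
    using pderiv_iszero by blast
  have "poly (G + pcompose G [:1, -1:]) 0 = h" "poly (G + pcompose G [:1, -1:]) (1 / 2) = h"
    unfolding h by simp_all
  then have "poly G 0 + poly G 1 = 2 * poly G (1 / 2)"
    by (simp add: poly_pcompose)
  moreover have "pderiv (smult 2 (pcompose G [:0, 1 / 2:])) = pcompose F [:0, 1 / 2:]"
    by (simp add: pderiv_smult pderiv_pcompose pderiv_pCons G)
  ultimately show ?thesis
    unfolding has_unit_integral_def
    using G by (intro exI[of _ "smult 2 (pcompose G [:0, 1 / 2:])"])
      (simp add: poly_pcompose algebra_simps)
qed

section \<open>Finite differences and alternating binomial sums\<close>

text \<open>An \<open>n\<close>-fold finite difference annihilates degrees below \<open>n\<close>.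
  Pascal's rule moves one difference from the binomial coefficients onto \<open>q\<close>.\<close>

lemma alternating_binomial_sum_eq_0:
  fixes q :: "'a::field_char_0 poly"
  assumes "degree q < n"
  shows "(\<Sum>k\<le>n. (-1) ^ k * of_nat (n choose k) * poly q (of_nat k)) = 0"
  using assms
proof (induction n arbitrary: q)
  case (Suc n)
  \<comment> \<open>The negated forward difference: the leading terms cancel, so the degree drops,
    or \<open>r = 0\<close> for constant \<open>q\<close>.\<close>
  define r where "r = q - pcompose q [:1, 1:]"
  have "(\<Sum>k\<le>Suc n. (-1) ^ k * of_nat (Suc n choose k) * poly q (of_nat k))
      = (\<Sum>k\<le>Suc n. (-1) ^ k * of_nat (n choose k) * poly q (of_nat k))
        + (\<Sum>k\<le>n. (-1) ^ Suc k * of_nat (n choose k) * poly q (of_nat (Suc k)))"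
    by (subst (1 2) sum.atMost_Suc_shift)
      (simp add: sum.distrib[symmetric] algebra_simps)
  also have "\<dots> = (\<Sum>k\<le>n. (-1) ^ k * of_nat (n choose k) * poly r (of_nat k))"
    by (simp add: r_def poly_pcompose sum.distrib[symmetric] algebra_simps)
  also have "\<dots> = 0"
  proof (cases "degree q = 0")
    case True
    then have "r = 0"
      by (auto simp: r_def elim!: degree_eq_zeroE)
    then show ?thesis
      by simp
  next
    case False
    have "degree (pcompose q [:1, 1:]) = degree q"
      by (simp add: degree_pcompose)
    moreover have "lead_coeff (pcompose q [:1, 1:]) = lead_coeff q"
      by (subst lead_coeff_comp) simp_all
    ultimately have "coeff r (degree q) = 0" "degree r \<le> degree q"
      by (simp_all add: r_def degree_diff_le)
    then have "degree r < degree q"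
      using False by (metis le_neq_implies_less leading_coeff_0_iff degree_0)
    then show ?thesis
      using Suc by simp
  qed
  finally show ?case .
qed simp

text \<open>Both sides integrate \<open>y^m (1-y)^n\<close> over [0,1], expanded binomially or taken
  as a beta integral.\<close>

lemma alternating_binomial_sum_divide:
  "(\<Sum>k\<le>n. (-1) ^ k * of_nat (n choose k) / of_nat (k + m + 1))
    = (fact m * fact n / fact (m + n + 1) :: 'a::field_char_0)"
proof (rule has_unit_integral_unique)
  have "[:1, -1:] ^ n = (\<Sum>k\<le>n. smult ((-1) ^ k * of_nat (n choose k)) (monom 1 k :: 'a poly))"
  proof (rule poly_eq_poly_eq_iff[THEN iffD1], rule ext)
    fix z :: 'a
    show "poly ([:1, -1:] ^ n) z
        = poly (\<Sum>k\<le>n. smult ((-1) ^ k * of_nat (n choose k)) (monom 1 k)) z"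
      using binomial_ring[of "-z" 1 n]
      by (simp add: poly_sum poly_monom power_minus[of z] algebra_simps)
  qed
  then have "monom 1 m * [:1, -1:] ^ n
      = (\<Sum>k\<le>n. smult ((-1) ^ k * of_nat (n choose k)) (monom 1 (k + m) :: 'a poly))"
    by (simp add: sum_distrib_left mult_monom add.commute)
  moreover have "has_unit_integral
      (\<Sum>k\<le>n. smult ((-1) ^ k * of_nat (n choose k)) (monom 1 (k + m) :: 'a poly))
      (\<Sum>k\<le>n. (-1) ^ k * of_nat (n choose k) * (1 / of_nat (Suc (k + m))))"
    by (intro has_unit_integral_sum has_unit_integral_smult has_unit_integral_monom)
  ultimately show "has_unit_integral (monom 1 m * [:1, -1:] ^ n :: 'a poly)
      (\<Sum>k\<le>n. (-1) ^ k * of_nat (n choose k) / of_nat (k + m + 1))"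
    by simp
qed (rule has_unit_integral_beta)

section \<open>Orthogonality of shifted Legendre polynomials\<close>

text \<open>The coefficient of \<open>(-y)^k\<close> in the Legendre polynomial
  \<open>P_a(1-2y)\<close>.\<close>

definition legendre_coeff :: "nat \<Rightarrow> nat \<Rightarrow> nat"
  where "legendre_coeff a k = (a choose k) * ((a + k) choose k)"

text \<open>The sum is the integral of \<open>y^m P_a(1-2y)\<close> over [0,1], so this is
  orthogonality to lower powers plus the top moment.\<close>

lemma legendre_moment:
  assumes "m \<le> a"
  shows "(\<Sum>k\<le>a. (-1) ^ k * of_nat (legendre_coeff a k) / of_nat (k + m + 1))
    = (if m = a then (-1) ^ a * (fact a)\<^sup>2 / fact (2 * a + 1) else 0 :: 'a::field_char_0)"
proof -
  \<comment> \<open>\<open>Q(k) = (k+1)...(k+a)\<close> turns the second binomial factor, times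
    \<open>a!\<close>, into a polynomial in \<open>k\<close>.\<close>
  define Q :: "'a poly" where "Q = (\<Prod>i<a. [:of_nat i + 1, 1:])"
  \<comment> \<open>The zero of the denominator \<open>z + m + 1\<close>. The remainder
    \<open>Q(c)\<close> is the product of all \<open>i - m\<close> with \<open>i < a\<close>, hence
    0 for \<open>m < a\<close>.\<close>
  define c :: 'a where "c = - of_nat (m + 1)"
  define r where "r = synthetic_div Q c"
  have Qk: "poly Q (of_nat k) = fact a * of_nat ((a + k) choose k)" for k
  proof -
    have "poly Q (of_nat k) = pochhammer (of_nat k + 1) a"
      by (simp add: Q_def poly_prod pochhammer_prod atLeast0LessThan algebra_simps)
    also have "\<dots> = fact (a + k) / fact k"
    proof -
      have "fact (k + a) = fact k * pochhammer (1 + of_nat k :: 'a) a"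
        unfolding pochhammer_fact by (rule pochhammer_product')
      then show ?thesis
        by (simp add: add.commute)
    qed
    finally show ?thesis
      by (simp add: binomial_fact)
  qed
  have degQ: "degree Q = a"
    unfolding Q_def by (subst degree_prod_eq_sum_degree) auto
  have sd: "poly Q z = (z + of_nat (m + 1)) * poly r z + poly Q c" for z
    using arg_cong[OF synthetic_div_correct'[of c Q], of "\<lambda>q. poly q z"]
    by (simp add: r_def c_def algebra_simps)
  have Qc: "poly Q c = (if m = a then (-1) ^ a * fact a else 0)"
  proof -
    have e: "poly Q c = (\<Prod>i<a. of_nat i - of_nat m)"
      by (simp add: Q_def c_def poly_prod algebra_simps)
    show ?thesis
    proof (cases "m = a")
      case True
      have "(\<Prod>i<a. of_nat i - of_nat a) = (\<Prod>i<a. - (of_nat (a - i) :: 'a))"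
        by (intro prod.cong) (auto simp: of_nat_diff)
      also have "\<dots> = (-1) ^ a * of_nat (\<Prod>i<a. a - i)"
        by (simp only: prod_uminus card_lessThan of_nat_prod)
      also have "(\<Prod>i<a. a - i) = fact a"
        by (simp add: fact_prod_rev atLeast0LessThan)
      finally show ?thesis
        using True e by simp
    next
      case False
      then have "m < a"
        using assms by simp
      then have "(\<Prod>i<a. of_nat i - of_nat m :: 'a) = 0"
        by (intro prod_zero) auto
      then show ?thesis
        using False e by simp
    qed
  qed
  define v where "v k = (-1) ^ k * (of_nat (a choose k) :: 'a)" for k
  \<comment> \<open>Dividing \<open>Q\<close> by \<open>z + m + 1\<close> leaves a quotient \<open>r\<close> of degree \<open>a - 1\<close>, which the
    alternating binomial sum annihilates, and a constant remainder.\<close>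
  have decomp: "(-1) ^ k * of_nat (legendre_coeff a k) / of_nat (k + m + 1)
      = (1 / fact a) * (v k * poly r (of_nat k))
        + (poly Q c / fact a) * (v k / of_nat (k + m + 1))" for k
  proof -
    define s :: 'a where "s = of_nat (k + m + 1)"
    have nz: "s \<noteq> 0"
      unfolding s_def using of_nat_neq_0[of "k + m"] by simp
    have "fact a * of_nat ((a + k) choose k) = s * poly r (of_nat k) + poly Q c"
      using sd[of "of_nat k"] Qk[of k] by (simp add: s_def add.assoc)
    then have "of_nat ((a + k) choose k) = (s * poly r (of_nat k) + poly Q c) / fact a"
      by (simp add: field_simps)
    then have "(-1) ^ k * of_nat (legendre_coeff a k)
        = v k * ((s * poly r (of_nat k) + poly Q c) / fact a)"
      by (simp add: legendre_coeff_def v_def)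
    then show ?thesis
      unfolding s_def[symmetric] using nz
      by (simp add: add_divide_distrib distrib_left ac_simps)
  qed
  have "(\<Sum>k\<le>a. v k * poly r (of_nat k)) = 0"
  \<comment> \<open>For \<open>a = 0\<close> the quotient has degree 0, not below \<open>a\<close>,
    but it is 0 itself.\<close>
  proof (cases "a = 0")
    case True
    then have "r = 0"
      by (simp add: r_def Q_def synthetic_div_eq_0_iff)
    then show ?thesis
      by simp
  next
    case False
    then show ?thesis
      unfolding v_def
      by (intro alternating_binomial_sum_eq_0) (simp add: r_def degree_synthetic_div degQ)
  qed
  moreover have "(\<Sum>k\<le>a. v k / of_nat (k + m + 1)) = fact m * fact a / fact (m + a + 1)"
    unfolding v_def by (rule alternating_binomial_sum_divide)
  ultimately have "(\<Sum>k\<le>a. (-1) ^ k * of_nat (legendre_coeff a k) / of_nat (k + m + 1))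
      = poly Q c / fact a * (fact m * fact a / fact (m + a + 1))"
    by (simp only: decomp sum.distrib sum_distrib_left[symmetric] mult_zero_right add_0_left)
  also have "\<dots> = (if m = a then (-1) ^ a * (fact a)\<^sup>2 / fact (2 * a + 1) else 0)"
  proof (cases "m = a")
    case True
    then have e: "m + a + 1 = 2 * a + 1"
      by simp
    show ?thesis
      unfolding e using True by (simp add: Qc power2_eq_square del: fact_Suc)
  qed (simp add: Qc)
  finally show ?thesis .
qed

definition legendre_shifted :: "nat \<Rightarrow> 'a::field_char_0 poly"
  where "legendre_shifted a = (\<Sum>k\<le>a. monom (of_nat (legendre_coeff a k)) k)"

definition beta_term :: "nat \<Rightarrow> nat \<Rightarrow> 'a::field_char_0"
  where "beta_term j k = (-1) ^ (j + k) * fact j * fact k / fact (j + k + 1)"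

text \<open>As \<open>2y - 2 = -2(1-y)\<close>, the product expands into beta integrands;
  \<open>beta_term\<close> absorbs the sign of \<open>(-2)^(j+k)\<close>.\<close>

lemma legendre_shifted_beta:
  "has_unit_integral
    (pcompose (legendre_shifted a) [:0, -2:] * pcompose (legendre_shifted a) [:-2, 2:])
    (\<Sum>j\<le>a. \<Sum>k\<le>a. of_nat (legendre_coeff a j) * 2 ^ j * (of_nat (legendre_coeff a k) * 2 ^ k)
      * beta_term j k :: 'a::field_char_0)"
proof -
  let ?c = "\<lambda>k. of_nat (legendre_coeff a k) :: 'a"
  have "pcompose (legendre_shifted a) [:0, -2:] * pcompose (legendre_shifted a) [:-2, 2:]
      = (\<Sum>j\<le>a. \<Sum>k\<le>a. smult (?c j * ?c k * (-2) ^ (j + k)) (monom 1 j * [:1, -1:] ^ k))"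
  proof (rule poly_eq_poly_eq_iff[THEN iffD1], rule ext)
    fix z :: 'a
    have e: "(-2 + z * 2) ^ k = (-2) ^ k * (1 - z) ^ k" for k
      by (simp add: power_mult_distrib[symmetric] algebra_simps)
    have "poly (pcompose (legendre_shifted a) [:0, -2:]) z = (\<Sum>j\<le>a. ?c j * ((-2) ^ j * z ^ j))"
      by (simp add: legendre_shifted_def poly_pcompose poly_sum poly_monom mult.commute[of z]
          power_mult_distrib[symmetric])
    moreover have "poly (pcompose (legendre_shifted a) [:-2, 2:]) z
        = (\<Sum>k\<le>a. ?c k * ((-2) ^ k * (1 - z) ^ k))"
      by (simp only: legendre_shifted_def poly_pcompose poly_sum poly_monom poly_pCons poly_0
          mult_zero_right add_0_right e)
    ultimately show
      "poly (pcompose (legendre_shifted a) [:0, -2:] * pcompose (legendre_shifted a) [:-2, 2:]) z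
      = poly (\<Sum>j\<le>a. \<Sum>k\<le>a. smult (?c j * ?c k * (-2) ^ (j + k)) (monom 1 j * [:1, -1:] ^ k)) z"
      by (simp add: poly_sum poly_monom sum_product power_add ac_simps)
  qed
  moreover have "has_unit_integral
      (\<Sum>j\<le>a. \<Sum>k\<le>a. smult (?c j * ?c k * (-2) ^ (j + k)) (monom 1 j * [:1, -1:] ^ k))
      (\<Sum>j\<le>a. \<Sum>k\<le>a. (?c j * ?c k * (-2) ^ (j + k)) * (fact j * fact k / fact (j + k + 1)))"
    by (intro has_unit_integral_sum has_unit_integral_smult has_unit_integral_beta)
  moreover have "(?c j * ?c k * (-2) ^ (j + k)) * (fact j * fact k / fact (j + k + 1))
      = ?c j * 2 ^ j * (?c k * 2 ^ k) * beta_term j k" for j k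
    by (simp add: beta_term_def power_minus[of 2] power_add)
  ultimately show ?thesis
    by simp
qed

text \<open>The first factor is orthogonal to \<open>v^m\<close> for \<open>m < a\<close>, so only
  the term \<open>v^a\<close> of the second counts; its coefficient, a central binomial coefficient,
  cancels the factorials.\<close>

lemma legendre_shifted_orthogonal:
  "has_unit_integral
    (pcompose (legendre_shifted a) [:0, -1:] * pcompose (legendre_shifted a) [:-2, 1:])
    ((-1) ^ a / of_nat (2 * a + 1) :: 'a::field_char_0)"
proof -
  let ?c = "\<lambda>k. of_nat (legendre_coeff a k) :: 'a"
  let ?d = "\<lambda>k m. ?c k * of_nat (k choose m) * (-2) ^ (k - m)"
  let ?O = "\<lambda>m. if m = a then (-1) ^ a * (fact a)\<^sup>2 / fact (2 * a + 1) else 0 :: 'a"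
  let ?F = "\<Sum>k\<le>a. \<Sum>m\<le>k. smult (?d k m) (\<Sum>i\<le>a. smult ((-1) ^ i * ?c i) (monom 1 (i + m)))"
  have "pcompose (legendre_shifted a) [:0, -1:] * pcompose (legendre_shifted a) [:-2, 1:] = ?F"
  proof (rule poly_eq_poly_eq_iff[THEN iffD1], rule ext)
    fix z :: 'a
    define P where "P = (\<Sum>i\<le>a. (-1) ^ i * ?c i * z ^ i)"
    have "poly (pcompose (legendre_shifted a) [:0, -1:]) z = P"
      by (simp add: legendre_shifted_def P_def poly_pcompose poly_sum poly_monom
          power_minus[of z] ac_simps)
    moreover have "poly (pcompose (legendre_shifted a) [:-2, 1:]) z
        = (\<Sum>k\<le>a. \<Sum>m\<le>k. ?d k m * z ^ m)"
    proof -
      have "(-2 + z) ^ k = (\<Sum>m\<le>k. of_nat (k choose m) * z ^ m * (-2) ^ (k - m))" for k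
        using binomial_ring[of z "-2" k] by (simp add: algebra_simps)
      then show ?thesis
        by (simp add: legendre_shifted_def poly_pcompose poly_sum poly_monom sum_distrib_left
            ac_simps)
    qed
    moreover have "poly ?F z = (\<Sum>k\<le>a. \<Sum>m\<le>k. ?d k m * z ^ m) * P"
      by (simp add: P_def poly_sum poly_monom sum_distrib_left sum_distrib_right power_add
          ac_simps)
    ultimately show
      "poly (pcompose (legendre_shifted a) [:0, -1:] * pcompose (legendre_shifted a) [:-2, 1:]) z
        = poly ?F z"
      by (simp only: poly_mult mult.commute)
  qed
  moreover have "has_unit_integral ?F (\<Sum>k\<le>a. \<Sum>m\<le>k. ?d k m *
      (\<Sum>i\<le>a. (-1) ^ i * ?c i * (1 / of_nat (Suc (i + m)))))"
    by (intro has_unit_integral_sum has_unit_integral_smult has_unit_integral_monom)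
  moreover have "(\<Sum>k\<le>a. \<Sum>m\<le>k. ?d k m * (\<Sum>i\<le>a. (-1) ^ i * ?c i * (1 / of_nat (Suc (i + m)))))
      = (-1) ^ a / of_nat (2 * a + 1)"
  proof -
    have "(\<Sum>k\<le>a. \<Sum>m\<le>k. ?d k m * (\<Sum>i\<le>a. (-1) ^ i * ?c i * (1 / of_nat (Suc (i + m)))))
        = (\<Sum>k\<le>a. \<Sum>m\<le>k. ?d k m * ?O m)"
    proof (intro sum.cong refl)
      fix k m assume "k \<in> {..a}" "m \<in> {..k}"
      then have "m \<le> a" by auto
      then show "?d k m * (\<Sum>i\<le>a. (-1) ^ i * ?c i * (1 / of_nat (Suc (i + m)))) = ?d k m * ?O m"
        using legendre_moment[of m a, where 'a='a] by simp
    qed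
    \<comment> \<open>\<open>m = a\<close> together with \<open>m \<le> k \<le> a\<close> forces
      \<open>k = a\<close>.\<close>
    also have "\<dots> = (\<Sum>k\<le>a. if k = a then ?c a * ?O a else 0)"
    proof (intro sum.cong refl)
      fix k assume k: "k \<in> {..a}"
      show "(\<Sum>m\<le>k. ?d k m * ?O m) = (if k = a then ?c a * ?O a else 0)"
      proof (cases "k = a")
        case True
        have "(\<Sum>m\<le>a. ?d a m * ?O m) = (\<Sum>m\<le>a. if m = a then ?d a m * ?O m else 0)"
          by (intro sum.cong) auto
        then show ?thesis
          using True by simp
      next
        case False
        then show ?thesis
          using k by (auto intro!: sum.neutral)
      qed
    qed
    also have "\<dots> = ?c a * ?O a"
      by simp
    also have "\<dots> = (-1) ^ a / of_nat (2 * a + 1)"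
    proof -
      have "?c a * (fact a)\<^sup>2 = fact (2 * a)"
        by (simp add: legendre_coeff_def binomial_fact power2_eq_square mult_2[symmetric])
      moreover have "fact (2 * a + 1) = of_nat (2 * a + 1) * (fact (2 * a) :: 'a)"
        by simp
      ultimately have "?c a * ((-1) ^ a * (fact a)\<^sup>2 / fact (2 * a + 1))
          = (-1) ^ a * fact (2 * a) / (of_nat (2 * a + 1) * fact (2 * a))"
        by (metis mult.left_commute times_divide_eq_right)
      then show ?thesis
        by simp
    qed
    finally show ?thesis .
  qed
  ultimately show ?thesis
    by simp
qed

text \<open>One integral evaluated twice: as a double sum of beta integrals and, after halving the
  argument, by orthogonality.\<close>

lemma legendre_beta_identity:
  "(\<Sum>j\<le>a. \<Sum>k\<le>a. of_nat (legendre_coeff a j) * 2 ^ j * (of_nat (legendre_coeff a k) * 2 ^ k)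
    * beta_term j k) = ((-1) ^ a / of_nat (2 * a + 1) :: 'a::field_char_0)"
proof -
  let ?L = "legendre_shifted a :: 'a poly"
  let ?F = "pcompose ?L [:0, -2:] * pcompose ?L [:-2, 2:]"
  have comp: "pcompose (pcompose ?L [:u, v:]) [:u', v':] = pcompose ?L [:u + u' * v, v * v':]"
    for u v u' v'
    by (simp add: pcompose_assoc[symmetric] pcompose_pCons mult.commute)
  \<comment> \<open>\<open>y \<mapsto> 1-y\<close> interchanges the factors \<open>P(-2y)\<close>
    and \<open>P(2y-2)\<close>.\<close>
  have "pcompose ?F [:1, -1:] = ?F"
    by (simp add: pcompose_mult comp mult.commute)
  from has_unit_integral_halve[OF legendre_shifted_beta this]
  have "has_unit_integral (pcompose ?L [:0, -1:] * pcompose ?L [:-2, 1:])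
      (\<Sum>j\<le>a. \<Sum>k\<le>a. of_nat (legendre_coeff a j) * 2 ^ j * (of_nat (legendre_coeff a k) * 2 ^ k)
        * beta_term j k)"
    by (simp add: pcompose_mult comp)
  then show ?thesis
    by (rule has_unit_integral_unique[OF _ legendre_shifted_orthogonal])
qed

section \<open>Congruences of \<open>p\<close>-adic integers\<close>

lemma padic_ints_0 [simp]: "0 \<in> padic_ints"
  and padic_ints_1 [simp]: "1 \<in> padic_ints"
  unfolding padic_ints_def by (metis rangeI to_fract_0, metis rangeI to_fract_1)

lemma padic_ints_add: "x \<in> padic_ints \<Longrightarrow> y \<in> padic_ints \<Longrightarrow> x + y \<in> padic_ints"
  unfolding padic_ints_def by (auto simp flip: to_fract_add)

lemma padic_ints_diff: "x \<in> padic_ints \<Longrightarrow> y \<in> padic_ints \<Longrightarrow> x - y \<in> padic_ints"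
  unfolding padic_ints_def by (auto simp flip: to_fract_diff)

lemma padic_ints_mult: "x \<in> padic_ints \<Longrightarrow> y \<in> padic_ints \<Longrightarrow> x * y \<in> padic_ints"
  unfolding padic_ints_def by (auto simp flip: to_fract_mult)

lemma padic_ints_uminus: "x \<in> padic_ints \<Longrightarrow> - x \<in> padic_ints"
  using padic_ints_diff[of 0 x] by simp

lemma padic_ints_power: "x \<in> padic_ints \<Longrightarrow> x ^ n \<in> padic_ints"
  by (induction n) (simp_all add: padic_ints_mult)

lemma padic_ints_of_nat: "of_nat n \<in> padic_ints"
  by (induction n) (simp_all add: padic_ints_add)

lemma padic_ints_of_int: "of_int i \<in> padic_ints"
  by (cases i) (simp_all add: padic_ints_of_nat padic_ints_uminus padic_ints_diff)

lemma padic_ints_numeral: "numeral n \<in> padic_ints"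
  using padic_ints_of_nat[of "numeral n"] by simp

lemma padic_ints_prod: "(\<And>i. i \<in> A \<Longrightarrow> f i \<in> padic_ints) \<Longrightarrow> prod f A \<in> padic_ints"
  by (induction A rule: infinite_finite_induct) (simp_all add: padic_ints_mult)

lemmas padic_ints_intros = padic_ints_0 padic_ints_1 padic_ints_add padic_ints_diff
  padic_ints_mult padic_ints_uminus padic_ints_power padic_ints_of_nat padic_ints_of_int
  padic_ints_numeral padic_ints_prod

section \<open>Units of the \<open>p\<close>-adic integers\<close>

text \<open>Coprimality to \<open>p\<close> at level 1 gives an inverse modulo every
  \<open>p^n\<close>; uniqueness of the inverses makes them compatible.\<close>

lemma padic_int_unit:
  fixes a :: "'p::prime_card padic_int"
  assumes "padic_residue a 1 \<noteq> 0"
  shows "\<exists>b. a * b = 1"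
proof -
  let ?p = "int CARD('p)"
  have cop: "coprime (padic_residue a n) (?p ^ n)" for n
  proof (cases n)
    case (Suc m)
    have "padic_residue a (1 + m) mod ?p ^ 1 = padic_residue a 1"
      by (rule padic_residue_add_mod)
    then have "\<not> ?p dvd padic_residue a n"
      using assms Suc by (auto simp: dvd_eq_mod_eq_0)
    then have "coprime ?p (padic_residue a n)"
      using prime_card_int[where 'a='p] by (rule prime_imp_coprime[rotated])
    then show ?thesis
      by (simp add: coprime_commute)
  qed simp
  have "\<exists>s. [padic_residue a n * s = 1] (mod ?p ^ n)" for n
    using cop by (rule cong_solve_coprime_int)
  then obtain s where s: "\<And>n. [padic_residue a n * s n = 1] (mod ?p ^ n)"
    by metis
  define f where "f n = s n mod ?p ^ n" for n
  have step: "f n = f (Suc n) mod ?p ^ n" for n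
  proof -
    have "[padic_residue a (Suc n) * s (Suc n) = 1] (mod ?p ^ n)"
      using s[of "Suc n"] by (rule cong_dvd_modulus) simp
    moreover have "[padic_residue a (Suc n) = padic_residue a n] (mod ?p ^ n)"
      using padic_residue_Suc[of a n] by (simp add: cong_def)
    ultimately have "[padic_residue a n * s (Suc n) = 1] (mod ?p ^ n)"
      by (meson cong_scalar_right cong_sym cong_trans)
    then have "[padic_residue a n * s n = padic_residue a n * s (Suc n)] (mod ?p ^ n)"
      using s[of n] by (meson cong_sym cong_trans)
    then have "[s n = s (Suc n)] (mod ?p ^ n)"
      using cop[of n] by (simp add: cong_mult_lcancel)
    then show ?thesis
      by (simp add: f_def cong_def mod_mod_cancel)
  qed
  define b :: "'p padic_int" where "b = Abs_padic_int f"
  have b: "padic_residue b = f"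
    unfolding b_def using step by (intro Abs_padic_int_inverse) blast
  have "a * b = 1"
  proof (rule padic_int_eqI)
    fix n
    show "padic_residue (a * b) n = padic_residue (1 :: 'p padic_int) n"
      using s[of n]
      by (simp add: times_padic_int.rep_eq one_padic_int.rep_eq b f_def cong_def mod_mult_right_eq)
  qed
  then show ?thesis ..
qed

lemma padic_ints_inverse:
  fixes x :: "'p::prime_card padic"
  assumes "x \<in> padic_ints" and "\<not> padic_cong x 0 (of_nat CARD('p))"
  shows "inverse x \<in> padic_ints"
proof -
  obtain a where x: "x = to_fract a"
    using assms(1) by (auto simp: padic_ints_def)
  have "\<not> padic_cong (to_fract a) (to_fract 0) (to_fract (of_nat CARD('p)))"
    using assms(2) unfolding x of_nat_eq_to_fract by simp
  then have "padic_residue a 1 \<noteq> 0"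
    by (simp only: padic_cong_to_fract_iff padic_int_dvd_iff diff_zero not_False_eq_True)
  then obtain b where "a * b = 1"
    using padic_int_unit by blast
  then have "x * to_fract b = 1"
    unfolding x by (simp flip: to_fract_mult)
  then have "inverse x = to_fract b"
    by (rule inverse_unique)
  then show ?thesis
    by (simp add: padic_ints_def)
qed

lemma padic_cong_of_nat_0_iff:
  "padic_cong (of_nat n :: 'p::prime_card padic) 0 (of_nat CARD('p)) \<longleftrightarrow> CARD('p) dvd n"
proof -
  have "padic_cong (of_nat n :: 'p padic) 0 (of_nat CARD('p))
      \<longleftrightarrow> padic_cong (to_fract (of_nat n) :: 'p padic) (to_fract 0) (to_fract (of_nat CARD('p)))"
    by (simp add: of_nat_eq_to_fract)
  also have "\<dots> \<longleftrightarrow> int n mod int CARD('p) = 0"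
    unfolding padic_cong_to_fract_iff padic_int_dvd_iff by (simp add: padic_residue_of_nat)
  finally show ?thesis
    by (metis dvd_eq_mod_eq_0 int_dvd_int_iff)
qed

lemma padic_ints_inverse_of_nat:
  "\<not> CARD('p) dvd n \<Longrightarrow> inverse (of_nat n :: 'p::prime_card padic) \<in> padic_ints"
  by (simp add: padic_ints_inverse padic_ints_of_nat padic_cong_of_nat_0_iff)

lemma padic_ints_fact: "fact n \<in> padic_ints"
  by (metis of_nat_fact padic_ints_of_nat)

lemma padic_ints_inverse_fact:
  assumes "n < CARD('p)"
  shows "inverse (fact n :: 'p::prime_card padic) \<in> padic_ints"
proof -
  have "\<not> CARD('p) dvd fact n"
    using assms prime_dvd_fact_iff[OF prime_card[where 'a='p]] by simp
  then show ?thesis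
    using padic_ints_inverse_of_nat by fastforce
qed

section \<open>Arithmetic of congruences\<close>

lemma padic_congI:
  "a \<in> padic_ints \<Longrightarrow> b \<in> padic_ints \<Longrightarrow> c \<in> padic_ints \<Longrightarrow> a - b = m * c \<Longrightarrow> padic_cong a b m"
  by (auto simp: padic_cong_def)

lemma padic_cong_refl: "a \<in> padic_ints \<Longrightarrow> padic_cong a a m"
  by (rule padic_congI[of _ _ 0]) simp_all

lemma padic_cong_sym:
  assumes "padic_cong a b m"
  shows "padic_cong b a m"
proof -
  obtain c where c: "a \<in> padic_ints" "b \<in> padic_ints" "c \<in> padic_ints" "a - b = m * c"
    using assms by (auto simp: padic_cong_def)
  then have "b - a = m * (- c)"
    by (simp add: algebra_simps)
  then show ?thesis
    using c by (intro padic_congI[of _ _ "- c"]) (simp_all add: padic_ints_uminus)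
qed

lemma padic_cong_add:
  assumes "padic_cong a b m" "padic_cong c d m"
  shows "padic_cong (a + c) (b + d) m"
proof -
  obtain e f where *: "a \<in> padic_ints" "b \<in> padic_ints" "c \<in> padic_ints" "d \<in> padic_ints"
    "e \<in> padic_ints" "f \<in> padic_ints" "a - b = m * e" "c - d = m * f"
    using assms by (auto simp: padic_cong_def)
  then have "a + c - (b + d) = m * (e + f)"
    by (simp add: algebra_simps)
  then show ?thesis
    using * by (intro padic_congI[of _ _ "e + f"]) (simp_all add: padic_ints_add)
qed

lemma padic_cong_mult:
  assumes "padic_cong a b m" "padic_cong c d m"
  shows "padic_cong (a * c) (b * d) m"
proof -
  obtain e f where *: "a \<in> padic_ints" "b \<in> padic_ints" "c \<in> padic_ints" "d \<in> padic_ints"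
    "e \<in> padic_ints" "f \<in> padic_ints" "a - b = m * e" "c - d = m * f"
    using assms by (auto simp: padic_cong_def)
  have "a * c - b * d = (a - b) * c + b * (c - d)"
    by (simp add: algebra_simps)
  also have "\<dots> = m * (e * c + b * f)"
    using * by (simp add: algebra_simps)
  finally show ?thesis
    using * by (intro padic_congI[of _ _ "e * c + b * f"]) (simp_all add: padic_ints_intros)
qed

text \<open>Gains precision: once a factor \<open>p\<close> is pulled out, the cofactor is needed
  only modulo \<open>p\<close> for a result modulo \<open>p^2\<close>.\<close>

lemma padic_cong_scale:
  assumes "padic_cong a b m" "r \<in> padic_ints"
  shows "padic_cong (r * a) (r * b) (r * m)"
proof -
  obtain c where *: "a \<in> padic_ints" "b \<in> padic_ints" "c \<in> padic_ints" "a - b = m * c"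
    using assms by (auto simp: padic_cong_def)
  then have "r * a - r * b = r * m * c"
    by (simp add: right_diff_distrib[symmetric] mult.assoc)
  then show ?thesis
    using * assms by (intro padic_congI[of _ _ c]) (simp_all add: padic_ints_mult)
qed

lemma padic_cong_modulus_dvd:
  assumes "padic_cong a b (m * r)" "r \<in> padic_ints"
  shows "padic_cong a b m"
  using assms unfolding padic_cong_def by (metis mult.assoc padic_ints_mult)

lemma padic_cong_minus:
  "padic_cong a b m \<Longrightarrow> padic_cong (- a) (- b) m"
  using padic_cong_mult[OF padic_cong_refl[of "-1" m]] by (fastforce simp: padic_ints_uminus)

lemma padic_cong_diff:
  "padic_cong a b m \<Longrightarrow> padic_cong c d m \<Longrightarrow> padic_cong (a - c) (b - d) m"
  using padic_cong_add[OF _ padic_cong_minus] by fastforce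

lemma padic_cong_trans:
  assumes "padic_cong a b m" "padic_cong b c m"
  shows "padic_cong a c m"
proof -
  have "padic_cong (a + b - b) (b + c - b) m"
    using assms by (intro padic_cong_add padic_cong_diff padic_cong_refl)
      (auto simp: padic_cong_def)
  then show ?thesis
    by simp
qed

lemma padic_cong_sum:
  "(\<And>i. i \<in> A \<Longrightarrow> padic_cong (f i) (g i) m) \<Longrightarrow> padic_cong (sum f A) (sum g A) m"
  by (induction A rule: infinite_finite_induct) (simp_all add: padic_cong_add padic_cong_refl)

lemma padic_cong_prod:
  "(\<And>i. i \<in> A \<Longrightarrow> padic_cong (f i) (g i) m) \<Longrightarrow> padic_cong (prod f A) (prod g A) m"
  by (induction A rule: infinite_finite_induct) (simp_all add: padic_cong_mult padic_cong_refl)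

text \<open>Multiply the given congruence by the integral number \<open>1/(ab)\<close>.\<close>

lemma padic_cong_inverse:
  assumes "padic_cong a b m" "inverse a \<in> padic_ints" "inverse b \<in> padic_ints" "a \<noteq> 0" "b \<noteq> 0"
  shows "padic_cong (inverse a) (inverse b) m"
proof -
  have "padic_cong (inverse a * inverse b * b) (inverse a * inverse b * a) m"
    using assms by (intro padic_cong_mult padic_cong_refl padic_cong_sym[OF assms(1)])
      (simp_all add: padic_ints_mult)
  moreover have "inverse a * inverse b * b = inverse a" "inverse a * inverse b * a = inverse b"
    using assms by (simp_all add: field_simps)
  ultimately show ?thesis
    by simp
qed

lemma padic_cong_of_int:
  assumes "[i = j] (mod int m)"
  shows "padic_cong (of_int i) (of_int j) (of_nat m :: 'p::prime_card padic)"
proof -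
  obtain k where "i - j = int m * k"
    using assms by (auto simp: cong_iff_dvd_diff dvd_def)
  then have "(of_int i - of_int j :: 'p padic) = of_nat m * of_int k"
    by (metis of_int_diff of_int_mult of_int_of_nat_eq)
  then show ?thesis
    by (intro padic_congI[of _ _ "of_int k"] padic_ints_of_int)
qed

section \<open>Sums of products of binomial coefficients\<close>

text \<open>Neighbours in row \<open>p - 1\<close> of Pascal's triangle add up to an entry divisible
  by \<open>p\<close>, so each is minus the previous one modulo \<open>p\<close>.\<close>

lemma prime_minus_one_choose_cong:
  assumes "prime (p::nat)" "j < p"
  shows "[int ((p - 1) choose j) = (-1) ^ j] (mod int p)"
  using assms(2)
proof (induction j)
  case (Suc j)
  have "p dvd (p choose Suc j)"
    using Suc assms(1) by (intro dvd_choose_prime) auto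
  moreover have "p choose Suc j = ((p - 1) choose j) + ((p - 1) choose Suc j)"
    using Suc.prems by (cases p) auto
  ultimately have "[int ((p - 1) choose j) + int ((p - 1) choose Suc j) = 0] (mod int p)"
    by (metis cong_0_iff int_dvd_int_iff of_nat_add)
  then have "[int ((p - 1) choose j) + int ((p - 1) choose Suc j) - int ((p - 1) choose j)
      = 0 - (-1) ^ j] (mod int p)"
    using Suc by (intro cong_diff) auto
  then show ?case
    by simp
qed simp

text \<open>Write \<open>(p-1)!\<close> as \<open>C(p-1,m) m! (p-1-m)!\<close> and apply Wilson's
  theorem.\<close>

lemma fact_mult_fact_cong:
  assumes "prime (p::nat)" "m < p"
  shows "[int (fact m * fact (p - 1 - m)) = (-1) ^ (m + 1)] (mod int p)"
proof -
  let ?w = "int (fact m * fact (p - 1 - m))"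
  have "fact (p - 1) = int ((p - 1) choose m) * ?w"
    using binomial_fact_lemma[of m "p - 1"] assms(2)
    by (metis Suc_diff_1 bot_nat_0.extremum_strict bot_nat_0.not_eq_extremum less_Suc_eq_le
        mult.commute of_nat_fact of_nat_mult)
  moreover have "[fact (p - 1) = (-1 :: int)] (mod int p)"
    using assms(1) by (rule wilson_theorem)
  ultimately have "[int ((p - 1) choose m) * ?w = -1] (mod int p)"
    by simp
  then have "[(-1) ^ m * ?w = -1] (mod int p)"
    using prime_minus_one_choose_cong[OF assms]
    by (meson cong_scalar_right cong_sym cong_trans)
  then have "[(-1) ^ m * ((-1) ^ m * ?w) = (-1) ^ m * -1] (mod int p)"
    by (rule cong_scalar_left)
  moreover have "(-1) ^ m * ((-1) ^ m * ?w) = ?w"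
    by (simp add: mult.assoc[symmetric] power_add[symmetric])
  ultimately show ?thesis
    by simp
qed

text \<open>Summation by parts: by Pascal's rule the three products at \<open>n\<close> form the
  increment of \<open>C(n,j+1) C(n,k+1)\<close> from \<open>n\<close> to
  \<open>n + 1\<close>.\<close>

lemma sum_choose_choose_rec:
  "(\<Sum>n<N. (n choose j) * (n choose Suc k)) + (\<Sum>n<N. (n choose Suc j) * (n choose k))
    + (\<Sum>n<N. (n choose j) * (n choose k)) = (N choose Suc j) * (N choose Suc k)"
  by (induction N) (simp_all add: algebra_simps)

text \<open>The recursion of \<open>sum_choose_choose_rec\<close> without boundary term.\<close>

lemma beta_term_Suc: "beta_term j (Suc k) = - beta_term j k - beta_term (Suc j) k"
  using arg_cong[OF beta_fact_rec[of j k], of "\<lambda>z. (-1) ^ (j + Suc k) * z"]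
  by (simp add: beta_term_def algebra_simps)

text \<open>Both sides obey the same recursion modulo \<open>p^2\<close>, where the boundary term
  \<open>C(p,j+1) C(p,k+1)\<close> vanishes. The range includes \<open>j + k = p - 1\<close>, where
  \<open>beta_term\<close> has denominator \<open>p\<close> and only its multiple by
  \<open>p\<close> is integral.\<close>

lemma sum_choose_choose_cong:
  assumes "odd CARD('p)" "j + k < CARD('p)"
  shows "padic_cong (of_nat (\<Sum>n<CARD('p). (n choose j) * (n choose k)) :: 'p::prime_card padic)
    (of_nat CARD('p) * beta_term j k) (of_nat (CARD('p)\<^sup>2))"
  using assms(2)
proof (induction k arbitrary: j)
  case 0
  let ?p = "CARD('p)" and ?m = "of_nat (CARD('p)\<^sup>2) :: 'p padic"
  have nz: "of_nat (Suc j) \<noteq> (0 :: 'p padic)"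
    by (rule of_nat_neq_0)
  have "(\<Sum>n<?p. (n choose j) * (n choose 0)) = (\<Sum>n\<le>?p - 1. n choose j)"
    using 0 by (intro sum.cong) auto
  also have "\<dots> = ?p choose Suc j"
    using 0 by (simp add: sum_choose_upper)
  finally have T: "(\<Sum>n<?p. (n choose j) * (n choose 0)) = ?p choose Suc j" .
  have beta: "beta_term j 0 = (-1) ^ j / (of_nat (Suc j) :: 'p padic)"
    by (simp add: beta_term_def del: of_nat_Suc)
  have "?p * ((?p - 1) choose j) = Suc j * (?p choose Suc j)"
    using binomial_absorption[of j ?p] by simp
  then have "of_nat ?p * of_nat ((?p - 1) choose j)
      = (of_nat (Suc j) * of_nat (?p choose Suc j) :: 'p padic)"
    by (metis of_nat_mult)
  then have C: "of_nat (?p choose Suc j)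
      = (of_nat ?p * (of_nat ((?p - 1) choose j) * inverse (of_nat (Suc j))) :: 'p padic)"
    using nz by (simp add: field_simps del: of_nat_Suc)
  show ?case
  \<comment> \<open>\<open>C(p,j+1)\<close> is \<open>p/(j+1)\<close> times \<open>C(p-1,j)\<close>.
    If \<open>j + 1 = p\<close>, both sides are 1, the sign being positive since \<open>p\<close> is
    odd; otherwise \<open>1/(j+1)\<close> is integral and \<open>C(p-1,j)\<close> matters only
    modulo \<open>p\<close>.\<close>
  proof (cases "Suc j = ?p")
    case True
    then have "even j"
      using assms(1) by (metis even_Suc)
    then have "of_nat ?p * beta_term j 0 = (1 :: 'p padic)"
      using nz True unfolding beta by simp
    then show ?thesis
      unfolding T using True by (simp add: padic_cong_refl)
  next
    case False
    then have "\<not> ?p dvd Suc j"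
      using 0 by (auto dest: dvd_imp_le)
    then have inv: "inverse (of_nat (Suc j) :: 'p padic) \<in> padic_ints"
      by (rule padic_ints_inverse_of_nat)
    have "padic_cong (of_nat ((?p - 1) choose j) :: 'p padic) ((-1) ^ j) (of_nat ?p)"
      using padic_cong_of_int[OF prime_minus_one_choose_cong[OF prime_card], where 'p='p] 0
      by simp
    then have "padic_cong (of_nat ?p * (of_nat ((?p - 1) choose j) * inverse (of_nat (Suc j))))
        (of_nat ?p * ((-1) ^ j * inverse (of_nat (Suc j)))) (of_nat ?p * (of_nat ?p :: 'p padic))"
      using inv by (intro padic_cong_scale padic_cong_mult padic_cong_refl padic_ints_of_nat)
    then show ?thesis
      unfolding T C beta by (simp add: power2_eq_square divide_inverse)
  qed
next
  case (Suc k)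
  let ?p = "CARD('p)" and ?m = "of_nat (CARD('p)\<^sup>2) :: 'p padic"
  let ?T = "\<lambda>j k. of_nat (\<Sum>n<?p. (n choose j) * (n choose k)) :: 'p padic"
  have "?p dvd (?p choose Suc j)" "?p dvd (?p choose Suc k)"
    using Suc.prems by (auto intro!: dvd_choose_prime prime_card)
  then obtain c where "(?p choose Suc j) * (?p choose Suc k) = ?p\<^sup>2 * c"
    unfolding power2_eq_square by (metis dvd_def mult_dvd_mono)
  then have "padic_cong (of_nat ((?p choose Suc j) * (?p choose Suc k))) 0 ?m"
    by (intro padic_congI[of _ _ "of_nat c"]) (simp_all add: padic_ints_intros)
  moreover have "padic_cong (?T j k) (of_nat ?p * beta_term j k) ?m"
    "padic_cong (?T (Suc j) k) (of_nat ?p * beta_term (Suc j) k) ?m"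
    using Suc.prems by (intro Suc.IH; simp)+
  ultimately have "padic_cong
      (of_nat ((?p choose Suc j) * (?p choose Suc k)) - ?T j k - ?T (Suc j) k)
      (0 - of_nat ?p * beta_term j k - of_nat ?p * beta_term (Suc j) k) ?m"
    by (intro padic_cong_diff)
  moreover have "?T j (Suc k)
      = of_nat ((?p choose Suc j) * (?p choose Suc k)) - ?T j k - ?T (Suc j) k"
    unfolding sum_choose_choose_rec[symmetric] of_nat_add by simp
  moreover have "0 - of_nat ?p * beta_term j k - of_nat ?p * beta_term (Suc j) k
      = (of_nat ?p * beta_term j (Suc k) :: 'p padic)"
    by (simp add: beta_term_Suc algebra_simps)
  ultimately show ?case
    by (simp only:)
qed

section \<open>The sum of squares modulo \<open>p\<^sup>2\<close>\<close>

text \<open>\<open>X\<close> stands for \<open>x(x+1)\<close>. This makes the symmetry under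
  \<open>x \<mapsto> -1-x\<close> manifest, and a congruence for \<open>X\<close> can hold to a
  higher power of \<open>p\<close> than the one for \<open>x\<close>.\<close>

definition central_prod :: "nat \<Rightarrow> 'a::field_char_0 \<Rightarrow> 'a"
  where "central_prod k X = (\<Prod>i<k. X - of_nat (i * (i + 1))) / (fact k)\<^sup>2"

lemma central_prod_factor:
  "X = x * (x + 1) \<Longrightarrow> X - of_nat (i * (i + 1)) = (x - of_nat i) * (x + of_nat i + 1)"
  for x :: "'a::comm_ring_1"
  by (simp add: algebra_simps)

lemma gbinomial_pair_eq_central_prod:
  "(x gchoose k) * ((x + of_nat k) gchoose k) = central_prod k (x * (x + 1))"
proof -
  have "(x gchoose k) = (\<Prod>i<k. x - of_nat i) / fact k"
    by (simp add: gbinomial_prod_rev atLeast0LessThan)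
  moreover have "((x + of_nat k) gchoose k) = (\<Prod>i<k. x + of_nat i + 1) / fact k"
    by (simp add: gbinomial_pochhammer' pochhammer_prod atLeast0LessThan algebra_simps)
  ultimately show ?thesis
    unfolding central_prod_def central_prod_factor[OF refl] prod.distrib
    by (simp add: power2_eq_square)
qed

lemma central_prod_of_nat:
  "central_prod k (of_nat a * (of_nat a + 1)) = (of_nat (legendre_coeff a k) :: 'a::field_char_0)"
  unfolding gbinomial_pair_eq_central_prod[symmetric]
  by (simp add: legendre_coeff_def binomial_gbinomial)

text \<open>Terms with \<open>k > n\<close> vanish, so all \<open>n < N\<close> share one range of
  \<open>k\<close> and the summations can be exchanged.\<close>

lemma t_poly_eq_central_prod:
  assumes "n < N"
  shows "t_poly n x = (\<Sum>k<N. of_nat (n choose k) * (central_prod k (x * (x + 1)) * 2 ^ k))"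
proof -
  have "t_poly n x = (\<Sum>k\<le>n. of_nat (n choose k) * (central_prod k (x * (x + 1)) * 2 ^ k))"
    unfolding gbinomial_pair_eq_central_prod[symmetric] t_poly_def
    by (simp add: atLeast0AtMost ac_simps)
  also have "\<dots> = (\<Sum>k<N. of_nat (n choose k) * (central_prod k (x * (x + 1)) * 2 ^ k))"
    using assms by (intro sum.mono_neutral_left) auto
  finally show ?thesis .
qed

lemma sum_t_poly_square:
  "(\<Sum>n<N. (t_poly n x)\<^sup>2) = (\<Sum>j<N. \<Sum>k<N.
    central_prod j (x * (x + 1)) * 2 ^ j * (central_prod k (x * (x + 1)) * 2 ^ k)
      * of_nat (\<Sum>n<N. (n choose j) * (n choose k)))"
proof -
  let ?y = "\<lambda>k. central_prod k (x * (x + 1)) * 2 ^ k"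
  have "(\<Sum>n<N. (t_poly n x)\<^sup>2)
      = (\<Sum>n<N. \<Sum>j<N. \<Sum>k<N. ?y j * ?y k * of_nat ((n choose j) * (n choose k)))"
    by (intro sum.cong refl)
      (simp add: t_poly_eq_central_prod power2_eq_square sum_product ac_simps)
  also have "\<dots> = (\<Sum>j<N. \<Sum>n<N. \<Sum>k<N. ?y j * ?y k * of_nat ((n choose j) * (n choose k)))"
    by (rule sum.swap)
  also have "\<dots> = (\<Sum>j<N. \<Sum>k<N. \<Sum>n<N. ?y j * ?y k * of_nat ((n choose j) * (n choose k)))"
    by (intro sum.cong refl sum.swap)
  finally show ?thesis
    by (simp add: sum_distrib_left)
qed

lemma central_prod_cong:
  fixes X :: "'p::prime_card padic"
  assumes "k < CARD('p)" "padic_cong X Y m"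
  shows "padic_cong (central_prod k X) (central_prod k Y) m"
  unfolding central_prod_def divide_inverse power_inverse[symmetric]
  using assms by (intro padic_cong_mult padic_cong_prod padic_cong_diff padic_cong_refl
      padic_ints_power padic_ints_of_nat padic_ints_inverse_fact)

lemma central_prod_remove:
  assumes "i < k"
  shows "central_prod k X
    = (X - of_nat (i * (i + 1))) * ((\<Prod>j\<in>{..<k} - {i}. X - of_nat (j * (j + 1))) / (fact k)\<^sup>2)"
  unfolding central_prod_def using assms by (subst prod.remove[of _ i]) auto

lemma sum_lessThan_restrict:
  "a < N \<Longrightarrow> (\<Sum>k<N. if k \<le> a then f k else 0) = (\<Sum>k\<le>a. f k)" for a N :: nat
  by (rule sum.mono_neutral_cong_right) auto

lemma sum_lessThan_restrict2:
  fixes a N :: nat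
  assumes "a < N"
  shows "(\<Sum>j<N. \<Sum>k<N. if j \<le> a \<and> k \<le> a then f j k else 0) = (\<Sum>j\<le>a. \<Sum>k\<le>a. f j k)"
proof -
  have "(\<Sum>k<N. if j \<le> a \<and> k \<le> a then f j k else 0) = (if j \<le> a then \<Sum>k\<le>a. f j k else 0)" for j
    using sum_lessThan_restrict[OF assms, of "f j"] by simp
  then show ?thesis
    using sum_lessThan_restrict[OF assms] by simp
qed

lemma prod_diff_remove:
  "(\<Prod>j\<in>{..<Suc a + d} - {a}. of_nat a - of_nat j) = (fact a * ((-1) ^ d * fact d) :: 'a::field_char_0)"
proof (induction d)
  case 0
  have "{..<Suc a + 0} - {a} = {..<a}"
    by auto
  moreover have "(\<Prod>j<a. of_nat a - of_nat j) = (\<Prod>j<a. of_nat (a - j) :: 'a)"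
    by (intro prod.cong) (auto simp: of_nat_diff)
  moreover have "\<dots> = of_nat (\<Prod>j<a. a - j)"
    by (simp only: of_nat_prod)
  moreover have "(\<Prod>j<a. a - j) = fact a"
    by (simp add: fact_prod_rev atLeast0LessThan)
  ultimately show ?case
    by simp
next
  case (Suc d)
  have "{..<Suc a + Suc d} - {a} = insert (Suc a + d) ({..<Suc a + d} - {a})"
    by auto
  then have "(\<Prod>j\<in>{..<Suc a + Suc d} - {a}. of_nat a - of_nat j :: 'a)
      = (of_nat a - of_nat (Suc a + d)) * (\<Prod>j\<in>{..<Suc a + d} - {a}. of_nat a - of_nat j)"
    by simp
  then show ?case
    unfolding Suc.IH by (simp add: algebra_simps)
qed

lemma prod_add_fact: "(\<Prod>j<n. of_nat a + of_nat j + 1) = (fact (a + n) / fact a :: 'a::field_char_0)"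
proof -
  have "fact (a + n) = fact a * pochhammer (1 + of_nat a :: 'a) n"
    unfolding pochhammer_fact by (rule pochhammer_product')
  moreover have "pochhammer (1 + of_nat a :: 'a) n = (\<Prod>j<n. of_nat a + of_nat j + 1)"
    by (simp add: pochhammer_prod atLeast0LessThan algebra_simps)
  ultimately show ?thesis
    by simp
qed

text \<open>Each factor splits as \<open>(a-j)(a+j+1)\<close>. The first product has
  \<open>a\<close> positive and \<open>d\<close> negative factors; in the second,
  \<open>2a+1\<close> restores the missing index \<open>j = a\<close>, which gives a quotient of
  factorials.\<close>

lemma central_prod_residual:
  "of_nat (2 * a + 1) * (\<Prod>j\<in>{..<Suc a + d} - {a}. of_nat a * (of_nat a + 1) - of_nat (j * (j + 1)))
    = ((-1) ^ d * fact d * fact (2 * a + 1 + d) :: 'a::field_char_0)"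
proof -
  have "(\<Prod>j<Suc a + d. of_nat a + of_nat j + 1)
      = of_nat (2 * a + 1) * (\<Prod>j\<in>{..<Suc a + d} - {a}. of_nat a + of_nat j + 1 :: 'a)"
    by (subst prod.remove[of _ a]) (auto simp: algebra_simps)
  moreover have "a + (Suc a + d) = 2 * a + 1 + d"
    by simp
  ultimately have "of_nat (2 * a + 1)
      * (\<Prod>j\<in>{..<Suc a + d} - {a}. of_nat a + of_nat j + 1 :: 'a)
      = fact (2 * a + 1 + d) / fact a" (is "?K * ?M = ?F / _")
    by (simp only: prod_add_fact)
  then have "((-1) ^ d * fact d) * (fact a * (?K * ?M)) = (-1) ^ d * fact d * ?F"
    by simp
  moreover have "K * (fact a * ((-1) ^ d * fact d) * M) = ((-1) ^ d * fact d) * (fact a * (K * M))"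
    for K M :: 'a
    by simp
  ultimately show ?thesis
    unfolding central_prod_factor[OF refl] prod.distrib prod_diff_remove by (rule trans[rotated])
qed

section \<open>The residue \<open>a = (p-1)/2\<close>\<close>

text \<open>Here \<open>x(x+1)\<close> is stationary at \<open>a\<close> modulo \<open>p\<close>, so
  it is known modulo \<open>p^2\<close> although \<open>x\<close> is known only modulo
  \<open>p\<close>. Legendre coefficients then replace all coefficients, and
  \<open>p/(2a+1) = 1\<close>.\<close>

lemma sum_t_poly_square_at_half:
  fixes x :: "'p::prime_card padic"
  assumes x: "x - of_nat a = of_nat CARD('p) * u" "u \<in> padic_ints"
    and a: "2 * a + 1 = CARD('p)"
  shows "padic_cong (\<Sum>n<CARD('p). (t_poly n x)\<^sup>2) ((-1) ^ a) (of_nat (CARD('p)\<^sup>2))"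
proof -
  let ?p = "CARD('p)"
  define q :: "'p padic" where "q = of_nat ?p"
  define y where "y k = central_prod k (x * (x + 1)) * 2 ^ k" for k
  define c :: "nat \<Rightarrow> 'p padic" where "c k = of_nat (legendre_coeff a k) * 2 ^ k" for k
  define T :: "nat \<Rightarrow> nat \<Rightarrow> 'p padic"
    where "T j k = of_nat (\<Sum>n<?p. (n choose j) * (n choose k))" for j k
  let ?m = "of_nat (?p\<^sup>2) :: 'p padic"
  have x': "x = of_nat a + q * u"
    using x(1) by (simp add: q_def algebra_simps)
  have q: "q = 2 * of_nat a + 1"
    unfolding q_def a[symmetric] by simp
  have "padic_cong (x * (x + 1)) (of_nat a * (of_nat a + 1)) ?m"
  proof (rule padic_congI)
    \<comment> \<open>The difference is \<open>pu(2a+1+pu)\<close>, and \<open>2a+1 = p\<close>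
      supplies the second \<open>p\<close>.\<close>
    show "x * (x + 1) - of_nat a * (of_nat a + 1) = ?m * (u * (u + 1))"
      unfolding of_nat_power q_def[symmetric] unfolding x' q by (simp add: algebra_simps power2_eq_square)
  qed (use x(2) in \<open>simp_all add: x' q_def padic_ints_intros\<close>)
  then have y: "padic_cong (y k) (c k) ?m" if "k < ?p" for k
    using central_prod_cong[OF that] unfolding y_def c_def central_prod_of_nat[symmetric]
    by (intro padic_cong_mult padic_cong_refl padic_ints_power padic_ints_numeral)
  have "padic_cong (y j * y k * T j k)
      (if j \<le> a \<and> k \<le> a then c j * c k * (q * beta_term j k) else 0) ?m"
    if jk: "j < ?p" "k < ?p" for j k
  proof (cases "j \<le> a \<and> k \<le> a")
    case True
    then have "padic_cong (T j k) (q * beta_term j k) ?m"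
      unfolding T_def q_def using a by (intro sum_choose_choose_cong) presburger+
    then show ?thesis
      using True y jk by (simp add: padic_cong_mult)
  next
    case False
    \<comment> \<open>An index above \<open>a\<close> kills its Legendre coefficient, so the
      integrality of \<open>T j k\<close> suffices here.\<close>
    then have "c j * c k = 0"
      by (auto simp: c_def legendre_coeff_def binomial_eq_0)
    moreover have "padic_cong (y j * y k * T j k) (c j * c k * T j k) ?m"
      using y jk unfolding T_def by (intro padic_cong_mult padic_cong_refl padic_ints_of_nat)
    ultimately show ?thesis
      by (simp only: if_not_P[OF False] mult_zero_left)
  qed
  then have "padic_cong (\<Sum>j<?p. \<Sum>k<?p. y j * y k * T j k)
      (\<Sum>j<?p. \<Sum>k<?p. if j \<le> a \<and> k \<le> a then c j * c k * (q * beta_term j k) else 0) ?m"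
    by (intro padic_cong_sum) auto
  also have "(\<Sum>j<?p. \<Sum>k<?p. if j \<le> a \<and> k \<le> a then c j * c k * (q * beta_term j k) else 0)
      = q * (\<Sum>j\<le>a. \<Sum>k\<le>a. c j * c k * beta_term j k)"
    using a by (subst sum_lessThan_restrict2) (auto simp: sum_distrib_left ac_simps)
  also have "\<dots> = (-1) ^ a"
    using a unfolding c_def legendre_beta_identity by (simp add: q_def)
  finally show ?thesis
    by (simp only: sum_t_poly_square y_def T_def)
qed

section \<open>The residue \<open>a < (p-1)/2\<close>\<close>

text \<open>Cancellation leaves \<open>-2^(p-1) (2a)! d! / (a! b!)\<close> with
  \<open>d = p-2-2a\<close>; Fermat's theorem and Wilson's theorem for two pairs of complementary
  factorials evaluate it.\<close>

lemma cross_coefficient_cong: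
  assumes a: "2 * a + 1 < CARD('p)" "odd CARD('p)" and b: "b = CARD('p) - 1 - a"
  shows "padic_cong
    (of_nat (legendre_coeff a a) * 2 ^ a
      * (of_nat (2 * a + 1) * ((\<Prod>j\<in>{..<b} - {a}. of_nat a * (of_nat a + 1) - of_nat (j * (j + 1)))
          / (fact b)\<^sup>2) * 2 ^ b)
      * (of_nat CARD('p) * beta_term a b))
    ((-1) ^ a * inverse (of_nat (2 * a + 1))) (of_nat CARD('p) :: 'p::prime_card padic)"
    (is "padic_cong ?lhs ?rhs ?q")
proof -
  let ?p = "CARD('p)"
  have prime: "prime ?p"
    by (rule prime_card)
  \<comment> \<open>The number of indices strictly between \<open>a\<close> and \<open>b\<close>; it
    is odd, which produces the minus sign.\<close>
  define d where "d = ?p - 2 - 2 * a"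
  have bd: "b = Suc a + d" "?p = a + b + 1" "odd d" "?p - 1 = 2 * a + 1 + d" "?p - 1 = a + b"
    using a unfolding b d_def by presburger+
  let ?w = "fact (2 * a + 1) * fact d :: 'p padic"
  let ?v = "fact a * fact b :: 'p padic"
  let ?i = "inverse (of_nat (2 * a + 1)) :: 'p padic"
  have nz: "of_nat (2 * a + 1) \<noteq> (0 :: 'p padic)"
    using of_nat_neq_0[of "2 * a"] by simp
  have eq: "?lhs = - (2 ^ (?p - 1) * ?w * ?i * inverse ?v)"
  proof -
    \<comment> \<open>The factor \<open>p\<close> cancels against the denominator \<open>p!\<close>
      of \<open>beta_term a b\<close>, leaving \<open>(p-1)!\<close>.\<close>
    have qb: "?q * beta_term a b = fact a * fact b / fact (?p - 1)"
    proof -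
      have "fact (a + b + 1) = ?q * (fact (?p - 1) :: 'p padic)"
        using bd(2) by (metis Suc_eq_plus1 add_diff_cancel_right' fact_Suc)
      moreover have "even (a + b)"
        using a bd by presburger
      ultimately show ?thesis
        by (simp add: beta_term_def)
    qed
    have C: "of_nat (legendre_coeff a a) = (fact (2 * a) / (fact a * fact a) :: 'p padic)"
      by (simp add: legendre_coeff_def binomial_fact mult_2[symmetric])
    have P: "of_nat (2 * a + 1)
        * (\<Prod>j\<in>{..<b} - {a}. of_nat a * (of_nat a + 1) - of_nat (j * (j + 1)))
        = (- (fact d * fact (?p - 1)) :: 'p padic)"
      unfolding bd(1,4) central_prod_residual using bd(3) by simp
    have "?lhs = fact (2 * a) / (fact a * fact a) * 2 ^ a
        * (- (fact d * fact (?p - 1)) / (fact b)\<^sup>2 * 2 ^ b) * (fact a * fact b / fact (?p - 1))"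
      unfolding C qb P[symmetric] by simp
    also have "\<dots> = - (2 ^ (a + b) * (fact (2 * a) * fact d) * inverse ?v)"
      by (simp add: field_simps power2_eq_square power_add)
    \<comment> \<open>Completing to \<open>(2a+1)!\<close> makes it complementary to
      \<open>d!\<close>, as \<open>(2a+1) + d = p - 1\<close>.\<close>
    also have "fact (2 * a) = fact (2 * a + 1) * ?i"
      using nz by (simp add: field_simps)
    finally show ?thesis
      using bd(5) by (simp add: ac_simps)
  qed
  have "\<not> ?p dvd 2"
    using primes_dvd_imp_eq[OF prime two_is_prime_nat] a by auto
  then have "[2 ^ (?p - 1) = 1] (mod ?p)"
    using prime by (rule fermat_theorem[rotated])
  then have "[int (2 ^ (?p - 1)) = int 1] (mod int ?p)"
    by (simp only: cong_int_iff)
  from padic_cong_of_int[OF this, where 'p='p]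
  have c1: "padic_cong (2 ^ (?p - 1)) 1 ?q"
    by simp
  have "?p - 1 - (2 * a + 1) = d"
    using a by (simp add: d_def)
  then have "[int (fact (2 * a + 1) * fact d) = (-1) ^ (2 * a + 1 + 1)] (mod int ?p)"
    using fact_mult_fact_cong[OF prime a(1)] by simp
  from padic_cong_of_int[OF this, where 'p='p]
  have c2: "padic_cong ?w 1 ?q"
    by (simp del: fact_Suc)
  have "?p - 1 - a = b"
    using b by simp
  then have "[int (fact a * fact b) = (-1) ^ (a + 1)] (mod int ?p)"
    using fact_mult_fact_cong[OF prime, of a] a by simp
  from padic_cong_of_int[OF this, where 'p='p]
  have "padic_cong ?v ((-1) ^ (a + 1)) ?q"
    by simp
  then have "padic_cong (inverse ?v) (inverse ((-1) ^ (a + 1))) ?q"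
  proof (rule padic_cong_inverse)
    have "a < ?p" "b < ?p"
      using bd(2) by linarith+
    then show "inverse ?v \<in> padic_ints"
      unfolding inverse_mult_distrib by (intro padic_ints_mult padic_ints_inverse_fact)
    show "inverse ((-1) ^ (a + 1)) \<in> (padic_ints :: 'p padic set)"
      by (simp add: power_inverse[symmetric] padic_ints_intros)
  qed simp_all
  moreover have "\<not> ?p dvd 2 * a + 1"
    using a by (auto dest: dvd_imp_le)
  then have "?i \<in> padic_ints"
    by (rule padic_ints_inverse_of_nat)
  ultimately have "padic_cong (- (2 ^ (?p - 1) * ?w * ?i * inverse ?v))
      (- (1 * 1 * ?i * inverse ((-1) ^ (a + 1)))) ?q"
    using c1 c2 by (intro padic_cong_minus padic_cong_mult padic_cong_refl)
  moreover have "- (1 * 1 * ?i * inverse ((-1) ^ (a + 1))) = ?rhs"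
    by (simp add: power_inverse[symmetric])
  ultimately show ?thesis
    unfolding eq by (simp only:)
qed

text \<open>Each \<open>y k\<close> with \<open>k > a\<close> carries the factor
  \<open>x - a = pu\<close>. Modulo \<open>p^2\<close>, the block \<open>j, k > a\<close> vanishes,
  the block \<open>j, k \<le> a\<close> is the Legendre identity, and mixed terms survive only at
  \<open>(a,b)\<close> and \<open>(b,a)\<close>, where no second \<open>p\<close> appears.\<close>

lemma sum_t_poly_square_below_half_aux:
  fixes x :: "'p::prime_card padic"
  assumes x: "x - of_nat a = of_nat CARD('p) * u" "u \<in> padic_ints"
    and a: "2 * a + 1 < CARD('p)" "odd CARD('p)"
  shows "padic_cong (\<Sum>n<CARD('p). (t_poly n x)\<^sup>2)
    (of_nat CARD('p) * ((-1) ^ a * (1 + 2 * u) * inverse (of_nat (2 * a + 1))))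
    (of_nat (CARD('p)\<^sup>2))"
proof -
  let ?p = "CARD('p)"
  define q :: "'p padic" where "q = of_nat ?p"
  define b where "b = ?p - 1 - a"
  define X where "X = x * (x + 1)"
  define A :: "'p padic" where "A = of_nat a * (of_nat a + 1)"
  define y where "y k = central_prod k X * 2 ^ k" for k
  define c :: "nat \<Rightarrow> 'p padic" where "c k = of_nat (legendre_coeff a k) * 2 ^ k" for k
  define T :: "nat \<Rightarrow> nat \<Rightarrow> 'p padic"
    where "T j k = of_nat (\<Sum>n<?p. (n choose j) * (n choose k))" for j k
  \<comment> \<open>The factor of index \<open>a\<close> is removed here; \<open>H\<close> restores
    its half \<open>x + a + 1\<close>, so that \<open>y k = p u H k\<close> for
    \<open>k > a\<close>.\<close>
  define R where "R k = (\<Prod>j\<in>{..<k} - {a}. X - of_nat (j * (j + 1))) / (fact k)\<^sup>2" for k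
  define H where "H k = (x + of_nat a + 1) * R k * 2 ^ k" for k
  \<comment> \<open>The value of each cross term: \<open>pu\<close> from \<open>y b\<close> times
    the value in \<open>cross_coefficient_cong\<close>.\<close>
  define E where "E = q * (u * ((-1) ^ a * inverse (of_nat (2 * a + 1))))"
  have m: "of_nat (?p\<^sup>2) = q * q"
    by (simp add: q_def power2_eq_square)
  have qZ: "q \<in> padic_ints"
    by (simp add: q_def padic_ints_of_nat)
  have ab: "a < b" "a + b + 1 = ?p" "b < ?p"
    using a by (auto simp: b_def)
  have x': "x = of_nat a + q * u"
    using x(1) by (simp add: q_def algebra_simps)
  have xZ: "x \<in> padic_ints" and XZ: "X \<in> padic_ints"
    using x(2) qZ by (simp_all add: x' X_def padic_ints_intros)
  have xa: "padic_cong x (of_nat a) q"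
    using x(2) xZ by (intro padic_congI[of _ _ u]) (simp_all add: x' padic_ints_of_nat)
  then have XA: "padic_cong X A q"
    unfolding X_def A_def
    by (intro padic_cong_mult padic_cong_add padic_cong_refl padic_ints_1)
  have yc: "padic_cong (y k) (c k) q" if "k < ?p" for k
    using central_prod_cong[OF that XA] unfolding y_def c_def A_def central_prod_of_nat
    by (intro padic_cong_mult padic_cong_refl padic_ints_power padic_ints_numeral)
  have yZ: "y k \<in> padic_ints" if "k < ?p" for k
    using yc[OF that] by (simp add: padic_cong_def)
  have TZ: "T j k \<in> padic_ints" for j k
    unfolding T_def by (rule padic_ints_of_nat)
  have factZ: "inverse ((fact k)\<^sup>2 :: 'p padic) \<in> padic_ints" if "k < ?p" for k
    unfolding power_inverse[symmetric]
    using that by (intro padic_ints_power padic_ints_inverse_fact)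
  have RZ: "R k \<in> padic_ints" if "k < ?p" for k
    unfolding R_def divide_inverse using XZ factZ[OF that] by (intro padic_ints_intros)
  have HZ: "H k \<in> padic_ints" if "k < ?p" for k
    unfolding H_def using RZ[OF that] xZ by (intro padic_ints_intros)
  have yH: "y k = q * (u * H k)" if "a < k" for k
    unfolding y_def H_def R_def central_prod_remove[OF that] central_prod_factor[OF X_def]
    by (simp add: x' ac_simps)
  \<comment> \<open>Index \<open>b\<close> contributes a second multiple of \<open>p\<close>,
    because \<open>x + b + 1 = p(u+1)\<close>.\<close>
  have y0: "padic_cong (y k) 0 (q * q)" if k: "b < k" "k < ?p" for k
  proof -
    define r where "r = (\<Prod>j\<in>{..<k} - {a} - {b}. X - of_nat (j * (j + 1))) * inverse ((fact k)\<^sup>2)"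
    define z where "z = u * ((x + of_nat a + 1) * ((x - of_nat b) * (u + 1) * r) * 2 ^ k)"
    have "(\<Prod>j\<in>{..<k} - {a}. X - of_nat (j * (j + 1)))
        = (X - of_nat (b * (b + 1))) * (\<Prod>j\<in>{..<k} - {a} - {b}. X - of_nat (j * (j + 1)))"
      using k ab by (intro prod.remove) auto
    moreover have "X - of_nat (b * (b + 1)) = (x - of_nat b) * (q * (u + 1))"
    proof -
      have "q = of_nat a + of_nat b + 1"
        unfolding q_def ab(2)[symmetric] by simp
      then have "x + of_nat b + 1 = q * (u + 1)"
        by (simp add: x' algebra_simps)
      then show ?thesis
        by (simp only: central_prod_factor[OF X_def])
    qed
    ultimately have "R k = q * ((x - of_nat b) * (u + 1) * r)"
      by (simp add: r_def R_def divide_inverse ac_simps)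
    then have "y k - 0 = q * q * z"
      using k ab by (simp add: yH H_def z_def ac_simps)
    moreover have "r \<in> padic_ints"
      unfolding r_def using XZ factZ[OF k(2)] by (intro padic_ints_intros)
    then have "z \<in> padic_ints"
      unfolding z_def using x(2) xZ by (intro padic_ints_intros)
    ultimately show ?thesis
      using yZ[OF k(2)] by (intro padic_congI[of _ _ z] padic_ints_0)
  qed
  have Tbeta: "padic_cong (T j k) (q * beta_term j k) (q * q)" if "j + k < ?p" for j k
    using sum_choose_choose_cong[OF a(2) that] by (simp only: T_def q_def m[unfolded q_def])
  have betaZ: "(beta_term j k :: 'p padic) \<in> padic_ints" if "j + k + 1 < ?p" for j k
    unfolding beta_term_def divide_inverse
    using padic_ints_inverse_fact[OF that] by (intro padic_ints_intros padic_ints_fact)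
  \<comment> \<open>As \<open>(j+k+1)!\<close> is prime to \<open>p\<close>,
    \<open>beta_term\<close> is integral and the factor \<open>p\<close> remains.\<close>
  have T0: "padic_cong (T j k) 0 q" if "j + k + 1 < ?p" for j k
  proof -
    have "padic_cong (q * beta_term j k) 0 q"
      using betaZ[OF that] qZ by (intro padic_congI[of _ _ "beta_term j k"])
        (simp_all add: padic_ints_mult)
    then show ?thesis
      using Tbeta[of j k] that qZ
      by (meson padic_cong_modulus_dvd padic_cong_trans add_lessD1)
  qed
  have cross: "padic_cong (y j * y k * T j k) (if j = a \<and> k = b then E else 0) (q * q)"
    if jk: "j \<le> a" "a < k" "k < ?p" for j k
  proof -
    have j: "j < ?p"
      using jk by simp
    \<comment> \<open>Beyond \<open>b\<close> two factors \<open>p\<close> come from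
      \<open>y k\<close>; up to \<open>b\<close> one comes from \<open>y k\<close> and one from
      \<open>T j k\<close>, except at the corner \<open>j + k + 1 = p\<close>.\<close>
    consider "b < k" | "k \<le> b" "\<not> (j = a \<and> k = b)" | "j = a" "k = b"
      by linarith
    then show ?thesis
    proof cases
      case 1
      then have "padic_cong (y j * y k * T j k) (y j * 0 * T j k) (q * q)"
        using y0 jk yZ j TZ by (intro padic_cong_mult padic_cong_refl) auto
      then show ?thesis
        using 1 by auto
    next
      case 2
      then have "j + k + 1 < ?p"
        using jk ab by linarith
      then have "padic_cong (q * (u * H k * y j * T j k)) (q * (u * H k * y j * 0)) (q * q)"
        using T0 HZ yZ jk j x(2) qZ
        by (intro padic_cong_scale padic_cong_mult padic_cong_refl padic_ints_mult) auto
      moreover have "y j * y k * T j k = q * (u * H k * y j * T j k)"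
        using jk by (simp add: yH)
      ultimately show ?thesis
        by (simp only: if_not_P[OF 2(2)] mult_zero_right)
    next
      case 3
      let ?H = "of_nat (2 * a + 1) * ((\<Prod>j\<in>{..<b} - {a}. A - of_nat (j * (j + 1))) / (fact b)\<^sup>2)
        * 2 ^ b"
      \<comment> \<open>Since \<open>y b\<close> supplies an exact factor \<open>q\<close>, every
        other factor matters only modulo \<open>p\<close>.\<close>
      have "padic_cong (x + of_nat a + 1) (of_nat a + of_nat a + 1) q"
        using xa by (intro padic_cong_add padic_cong_refl padic_ints_of_nat padic_ints_1)
      then have "padic_cong (x + of_nat a + 1) (of_nat (2 * a + 1)) q"
        by (simp only: of_nat_add of_nat_mult of_nat_numeral of_nat_1 mult_2)
      moreover have "padic_cong (R b)
          ((\<Prod>j\<in>{..<b} - {a}. A - of_nat (j * (j + 1))) / (fact b)\<^sup>2) q"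
        unfolding R_def divide_inverse using XA factZ[OF ab(3)]
        by (intro padic_cong_mult padic_cong_prod padic_cong_diff padic_cong_refl padic_ints_of_nat)
      ultimately have "padic_cong (H b) ?H q"
        unfolding H_def
        by (intro padic_cong_mult padic_cong_refl padic_ints_power padic_ints_numeral)
      moreover have "padic_cong (T a b) (q * beta_term a b) q"
        using ab(2) by (intro padic_cong_modulus_dvd[OF Tbeta qZ]) linarith
      moreover have "padic_cong (y a) (c a) q"
        using yc j 3 by simp
      ultimately have "padic_cong (y a * H b * T a b) (c a * ?H * (q * beta_term a b)) q"
        by (intro padic_cong_mult)
      moreover have "padic_cong (c a * ?H * (q * beta_term a b))
          ((-1) ^ a * inverse (of_nat (2 * a + 1))) q"
        unfolding c_def A_def q_def using a b_def by (rule cross_coefficient_cong)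
      ultimately have "padic_cong (y a * H b * T a b) ((-1) ^ a * inverse (of_nat (2 * a + 1))) q"
        by (rule padic_cong_trans)
      then have "padic_cong (q * (u * (y a * H b * T a b))) E (q * q)"
        unfolding E_def using x(2) qZ
        by (intro padic_cong_scale padic_cong_mult[OF padic_cong_refl])
      moreover have "y a * y b * T a b = q * (u * (y a * H b * T a b))"
        using ab by (simp add: yH)
      ultimately show ?thesis
        unfolding 3 by (simp only: simp_thms if_True)
    qed
  qed
  \<comment> \<open>Collects the predicted values of all terms; nested conditionals make the cross
    terms collapse one sum at a time.\<close>
  define W where "W j k = (if j \<le> a \<and> k \<le> a then c j * c k * (q * beta_term j k) else 0)
    + (if j = a then if k = b then E else 0 else 0) + (if j = b then if k = a then E else 0 else 0)"
    for j k
  have "padic_cong (y j * y k * T j k) (W j k) (q * q)" if jk: "j < ?p" "k < ?p" for j k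
  proof -
    consider "j \<le> a" "k \<le> a" | "j \<le> a" "a < k" | "a < j" "k \<le> a" | "a < j" "a < k"
      by linarith
    then show ?thesis
    proof cases
      case 1
      then have *: "j + k + 1 < ?p"
        using a by linarith
      \<comment> \<open>Two stages: \<open>T j k\<close> is replaced modulo \<open>p^2\<close>; the
        factor \<open>q\<close> gained then lets \<open>c\<close> replace \<open>y\<close>, with
        which it agrees only modulo \<open>p\<close>.\<close>
      have "padic_cong (y j * y k * T j k) (q * (y j * y k * beta_term j k)) (q * q)"
        unfolding mult.left_commute[of q]
        using Tbeta[of j k] * yZ jk by (intro padic_cong_mult padic_cong_refl) auto
      moreover have "padic_cong (q * (y j * y k * beta_term j k)) (q * (c j * c k * beta_term j k)) (q * q)"
        using yc jk betaZ[OF *] qZ by (intro padic_cong_scale padic_cong_mult padic_cong_refl)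
      ultimately have "padic_cong (y j * y k * T j k) (c j * c k * (q * beta_term j k)) (q * q)"
        unfolding mult.left_commute[of "c j * c k"] by (rule padic_cong_trans)
      moreover have "W j k = c j * c k * (q * beta_term j k)"
        using 1 ab(1) by (auto simp: W_def)
      ultimately show ?thesis
        by (simp only:)
    next
      case 2
      then have "W j k = (if j = a \<and> k = b then E else 0)"
        using ab by (auto simp: W_def)
      then show ?thesis
        using cross[OF 2 jk(2)] by (simp only:)
    next
      case 3
      then have "W j k = (if k = a \<and> j = b then E else 0)"
        using ab by (auto simp: W_def)
      moreover have "y j * y k * T j k = y k * y j * T k j"
        by (simp add: T_def ac_simps)
      ultimately show ?thesis
        using cross[OF 3(2,1) jk(1)] by (simp only:)
    next
      case 4
      then have "W j k = 0"
        using ab by (auto simp: W_def)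
      moreover have "y j * y k * T j k - 0 = q * q * (u * H j * (u * H k) * T j k)"
        using 4 by (simp add: yH)
      ultimately show ?thesis
        using HZ x(2) jk TZ yZ
        by (intro padic_congI[of _ _ "u * H j * (u * H k) * T j k"])
          (simp_all add: padic_ints_mult)
    qed
  qed
  then have "padic_cong (\<Sum>j<?p. \<Sum>k<?p. y j * y k * T j k) (\<Sum>j<?p. \<Sum>k<?p. W j k) (q * q)"
    by (intro padic_cong_sum) auto
  also have "(\<Sum>j<?p. \<Sum>k<?p. W j k)
      = (\<Sum>j\<le>a. \<Sum>k\<le>a. c j * c k * (q * beta_term j k)) + E + E"
  proof -
    have "(\<Sum>j<?p. \<Sum>k<?p. if j = i then if k = i' then E else 0 else 0) = E"
      if "i < ?p" "i' < ?p" for i i'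
    proof -
      have "(\<Sum>k<?p. if j = i then if k = i' then E else 0 else 0) = (if j = i then E else 0)" for j
        using that by simp
      then show ?thesis
        using that by simp
    qed
    then show ?thesis
      unfolding W_def sum.distrib using ab by (simp add: sum_lessThan_restrict2)
  qed
  also have "(\<Sum>j\<le>a. \<Sum>k\<le>a. c j * c k * (q * beta_term j k))
      = q * (\<Sum>j\<le>a. \<Sum>k\<le>a. c j * c k * beta_term j k)"
    by (simp add: sum_distrib_left ac_simps)
  also have "\<dots> = q * ((-1) ^ a / of_nat (2 * a + 1))"
    unfolding c_def legendre_beta_identity ..
  also have "\<dots> + E + E = q * ((-1) ^ a * (1 + 2 * u) * inverse (of_nat (2 * a + 1)))"
    by (simp add: E_def divide_inverse distrib_left distrib_right)
  finally show ?thesis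
    by (simp only: sum_t_poly_square y_def T_def X_def m q_def)
qed

text \<open>Since \<open>p + 2(x-a) = p(1+2u)\<close>, the denominator matters only modulo
  \<open>p\<close>, where the unit \<open>2x+1\<close> may replace \<open>2a+1\<close>.\<close>

lemma sum_t_poly_square_below_half:
  fixes x :: "'p::prime_card padic"
  assumes x: "x - of_nat a = of_nat CARD('p) * u" "u \<in> padic_ints"
    and a: "2 * a + 1 < CARD('p)" "odd CARD('p)"
  shows "padic_cong (\<Sum>n<CARD('p). (t_poly n x)\<^sup>2)
    ((-1) ^ a * ((of_nat CARD('p) + 2 * (x - of_nat a)) / (2 * x + 1)))
    (of_nat (CARD('p)\<^sup>2))"
proof -
  define q :: "'p padic" where "q = of_nat CARD('p)"
  have qZ: "q \<in> padic_ints"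
    by (simp add: q_def padic_ints_of_nat)
  have x': "x = of_nat a + q * u"
    using x(1) by (simp add: q_def algebra_simps)
  have xZ: "x \<in> padic_ints"
    using x(2) qZ by (simp add: x' padic_ints_intros)
  have dvd: "\<not> CARD('p) dvd 2 * a + 1"
    using a by (auto dest: dvd_imp_le)
  have cong: "padic_cong (2 * x + 1) (of_nat (2 * a + 1)) q"
    using x(2) xZ by (intro padic_congI[of _ _ "2 * u"] padic_ints_intros)
      (simp_all add: x' algebra_simps)
  have n0: "\<not> padic_cong (2 * x + 1) 0 q"
  proof
    assume "padic_cong (2 * x + 1) 0 q"
    then have "padic_cong (of_nat (2 * a + 1)) 0 q"
      by (rule padic_cong_trans[OF padic_cong_sym[OF cong]])
    then show False
      using dvd unfolding q_def padic_cong_of_nat_0_iff by contradiction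
  qed
  then have "2 * x + 1 \<noteq> 0"
    using padic_cong_refl[OF padic_ints_0, of q] by auto
  moreover have "inverse (2 * x + 1) \<in> padic_ints"
    using n0 xZ unfolding q_def by (intro padic_ints_inverse padic_ints_intros)
  moreover have "of_nat (2 * a + 1) \<noteq> (0 :: 'p padic)"
    using of_nat_neq_0[of "2 * a"] by simp
  ultimately have "padic_cong (inverse (2 * x + 1)) (inverse (of_nat (2 * a + 1))) q"
    using cong padic_ints_inverse_of_nat[OF dvd] by (intro padic_cong_inverse)
  then have "padic_cong (q * ((-1) ^ a * (1 + 2 * u) * inverse (2 * x + 1)))
      (q * ((-1) ^ a * (1 + 2 * u) * inverse (of_nat (2 * a + 1)))) (q * q)"
    using x(2) qZ by (intro padic_cong_scale padic_cong_mult padic_cong_refl padic_ints_intros)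
  moreover have "q * ((-1) ^ a * (1 + 2 * u) * inverse (2 * x + 1))
      = (-1) ^ a * ((q + 2 * (x - of_nat a)) / (2 * x + 1))"
  proof -
    have "q * (s * (1 + 2 * u) * i) = s * ((q + 2 * (q * u)) * i)" for s i
      by (simp add: algebra_simps)
    then show ?thesis
      unfolding x(1)[folded q_def] divide_inverse .
  qed
  moreover have "of_nat (CARD('p)\<^sup>2) = q * q"
    by (simp add: q_def power2_eq_square)
  ultimately have "padic_cong ((-1) ^ a * ((q + 2 * (x - of_nat a)) / (2 * x + 1)))
      (q * ((-1) ^ a * (1 + 2 * u) * inverse (of_nat (2 * a + 1)))) (of_nat (CARD('p)\<^sup>2))"
    by (simp only:)
  from padic_cong_trans[OF sum_t_poly_square_below_half_aux[OF assms] padic_cong_sym[OF this[unfolded q_def]]]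
  show ?thesis .
qed

section \<open>Legendre symbol, reflection and the three cases\<close>

text \<open>Euler's criterion gives a congruence modulo \<open>p\<close>, and both values differ by
  at most 2, which is less than \<open>p\<close>.\<close>

lemma Legendre_minus_one:
  assumes "prime p" "p = 2 * a + 1"
  shows "Legendre (-1) (int p) = (-1) ^ a"
proof -
  have p: "2 < int p"
    using assms prime_gt_1_nat[of p] by auto
  have "[Legendre (-1) (int p) = (-1) ^ ((p - 1) div 2)] (mod int p)"
    using assms p by (intro euler_criterion) auto
  then have dvd: "int p dvd Legendre (-1) (int p) - (-1) ^ a"
    using assms by (simp add: cong_iff_dvd_diff)
  have "\<bar>Legendre (-1) (int p) - (-1) ^ a\<bar> \<le> 2"
    by (cases "even a") (auto simp: Legendre_def)
  then have "Legendre (-1) (int p) - (-1) ^ a = 0"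
    using dvd p dvd_imp_le_int[of "Legendre (-1) (int p) - (-1) ^ a" "int p"] by linarith
  then show ?thesis
    by simp
qed

text \<open>Serves to trade a residue \<open>a > (p-1)/2\<close> for the residue
  \<open>p-1-a\<close> of \<open>-1-x\<close>.\<close>

lemma t_poly_reflect: "t_poly n (-1 - x) = t_poly n x"
proof -
  have "(-1 - x) * (-1 - x + 1) = x * (x + 1)"
    by (simp add: algebra_simps)
  then show ?thesis
    by (simp only: t_poly_eq_central_prod[OF lessI])
qed

theorem theorem1p1:
  fixes x :: "'p::prime_card padic" and p :: nat
  assumes "p = CARD('p)" and "odd p" and "x \<in> padic_ints"
  shows "padic_cong (\<Sum>n=0..p-1. (t_poly n x)\<^sup>2)
    (if padic_cong (2 * x) (-1) (of_nat p)
     then of_int (Legendre (-1) (int p))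
     else (-1) ^ least_residue x
       * ((of_nat p + 2 * (x - of_nat (least_residue x))) / (2 * x + 1)))
    (of_nat (p\<^sup>2))"
proof -
  define a where "a = least_residue x"
  have prime: "prime p"
    using prime_card[where 'a='p] assms(1) by simp
  have "a < CARD('p) \<and> padic_cong x (of_nat a) (of_nat CARD('p))"
    unfolding a_def least_residue_def by (rule theI'[OF least_residue_unique[OF assms(3)]])
  then have ap: "a < p" and xa: "padic_cong x (of_nat a) (of_nat p)"
    using assms(1) by simp_all
  then obtain u where u: "x - of_nat a = of_nat p * u" "u \<in> padic_ints"
    by (auto simp: padic_cong_def)
  have range: "{0..p - 1} = {..<p}"
    using ap by auto
  have "padic_cong (2 * x) (-1) (of_nat p) \<longleftrightarrow> padic_cong (2 * x + 1) 0 (of_nat p)"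
    using assms(3) by (simp add: padic_cong_def padic_ints_intros)
  also have "\<dots> \<longleftrightarrow> padic_cong (of_nat (2 * a + 1) :: 'p padic) 0 (of_nat p)"
  proof -
    have "padic_cong (2 * x + 1) (2 * of_nat a + 1) (of_nat p)"
      using xa by (intro padic_cong_add padic_cong_mult padic_cong_refl padic_ints_numeral
          padic_ints_1)
    then have "padic_cong (2 * x + 1) (of_nat (2 * a + 1)) (of_nat p)"
      by (simp only: of_nat_add of_nat_mult of_nat_numeral of_nat_1)
    then show ?thesis
      using padic_cong_trans padic_cong_sym by blast
  qed
  also have "\<dots> \<longleftrightarrow> p dvd 2 * a + 1"
    unfolding assms(1) by (rule padic_cong_of_nat_0_iff)
  \<comment> \<open>Since \<open>0 < 2a+1 < 2p\<close>, the only candidate multiple is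
    \<open>p\<close> itself.\<close>
  also have "\<dots> \<longleftrightarrow> 2 * a + 1 = p"
  proof
    assume "p dvd 2 * a + 1"
    then obtain c where c: "2 * a + 1 = p * c" ..
    then have "p * c < p * 2"
      using ap by linarith
    then have "c < 2"
      by simp
    moreover have "c \<noteq> 0"
      using c by (metis add_is_0 mult_0_right one_neq_zero)
    ultimately have "c = 1"
      by simp
    then show "2 * a + 1 = p"
      using c by simp
  qed simp
  finally have half: "padic_cong (2 * x) (-1) (of_nat p) \<longleftrightarrow> 2 * a + 1 = p" .
  consider "2 * a + 1 = p" | "2 * a + 1 < p" | "p < 2 * a + 1"
    by linarith
  then show ?thesis
  proof cases
    case 1
    have "padic_cong (\<Sum>n<p. (t_poly n x)\<^sup>2) ((-1) ^ a) (of_nat (p\<^sup>2))"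
      using sum_t_poly_square_at_half[OF u[unfolded assms(1)] 1[unfolded assms(1)]]
      unfolding assms(1) .
    then show ?thesis
      unfolding range if_P[OF half[THEN iffD2, OF 1]] Legendre_minus_one[OF prime 1[symmetric]]
      by simp
  next
    case 2
    then have "\<not> padic_cong (2 * x) (-1) (of_nat p)"
      unfolding half by simp
    then show ?thesis
      using sum_t_poly_square_below_half[OF u[unfolded assms(1)] 2[unfolded assms(1)]
          assms(2)[unfolded assms(1)]]
      unfolding range a_def[symmetric] unfolding assms(1) by (simp only: if_False)
  next
    case 3
    \<comment> \<open>The residue of \<open>-1-x\<close>, which falls under the preceding case with
      \<open>-(u+1)\<close> in place of \<open>u\<close>.\<close>
    define b where "b = p - 1 - a"
    have b: "of_nat b = (of_nat p - 1 - of_nat a :: 'p padic)"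
      using ap by (simp add: b_def of_nat_diff)
    have "2 * b + 1 < p"
      using 3 ap by (simp add: b_def)
    moreover have "-1 - x - of_nat b = of_nat p * (- (u + 1))"
      using u(1) unfolding b by (simp add: algebra_simps)
    moreover have "- (u + 1) \<in> padic_ints"
      using u(2) by (simp add: padic_ints_intros)
    ultimately have "padic_cong (\<Sum>n<p. (t_poly n (-1 - x))\<^sup>2)
        ((-1) ^ b * ((of_nat p + 2 * (-1 - x - of_nat b)) / (2 * (-1 - x) + 1))) (of_nat (p\<^sup>2))"
      using sum_t_poly_square_below_half[of "-1 - x" b "- (u + 1)"] assms(2) unfolding assms(1) by blast
    \<comment> \<open>Reflection changes the sign of both numerator and denominator.\<close>
    moreover have "(of_nat p + 2 * (-1 - x - of_nat b)) / (2 * (-1 - x) + 1)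
        = (of_nat p + 2 * (x - of_nat a)) / (2 * x + 1)"
    proof -
      have "of_nat p + 2 * (-1 - x - of_nat b) = - (of_nat p + 2 * (x - of_nat a))"
        unfolding b by (simp add: algebra_simps)
      moreover have "2 * (-1 - x) + 1 = - (2 * x + 1)"
        by (simp add: algebra_simps)
      ultimately show ?thesis
        by (simp only: minus_divide_divide)
    qed
    moreover have "(-1) ^ b = ((-1) ^ a :: 'p padic)"
    proof -
      have "even (a + b)"
        using ap assms(2) by (simp add: b_def)
      then show ?thesis
        by (cases "even a") auto
    qed
    moreover have "\<not> padic_cong (2 * x) (-1) (of_nat p)"
      unfolding half using 3 by simp
    ultimately show ?thesis
      unfolding range a_def[symmetric] by (simp only: t_poly_reflect if_False)
  qed
qed

end
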